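(* For every positive integer $n$ there is a constant $C(n)$, depending only on $n$, such that the following holds. Let $R>0$, let $\Theta\in\mathbb{R}$ with $|\Theta|\ge (n-2)\frac{\pi}{2}$, and let $u$ be a smooth real-valued function on $B_{3R}(0)\subset\mathbb{R}^n$ satisfying the special Lagrangian equation $\sum_{i=1}^{n}\arctan\lambda_i=\Theta$ on $B_{3R}(0)$, where $\lambda_1,\dots,\lambda_n$ are the eigenvalues of the Hessian $D^2u$. Then $$\max_{B_R(0)}|Du|\le C(n)\left[\operatorname*{osc}_{B_{3R}(0)}\frac{u}{R}+1\right].$$
   Context: $B_r(0)$ is the Euclidean ball of radius $r$ centered at the origin, and $\operatorname{osc}_{B}v=\sup_B v-\inf_B v$ (the estimate is trivial if this is infinite). *)

theory Defs
  imports
    "HOL-Analysis.Analysis"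
    "HOL-Computational_Algebra.Polynomial"
begin

definition partial_deriv :: "'n::finite \<Rightarrow> (real ^ 'n \<Rightarrow> real) \<Rightarrow> real ^ 'n \<Rightarrow> real" where
  "partial_deriv i u x = frechet_derivative u (at x) (axis i 1)"

definition gradient :: "(real ^ 'n::finite \<Rightarrow> real) \<Rightarrow> real ^ 'n \<Rightarrow> real ^ 'n" where
  "gradient u x = (\<chi> i. partial_deriv i u x)"

definition hessian :: "(real ^ 'n::finite \<Rightarrow> real) \<Rightarrow> real ^ 'n \<Rightarrow> real ^ 'n ^ 'n" where
  "hessian u x = (\<chi> i j. partial_deriv i (partial_deriv j u) x)"

text \<open>The derivatives are two-sided (\<open>at x\<close>, not \<open>at x within S\<close>), so the following is meant
  for open \<open>S\<close>.\<close>

primrec Ck_on :: "nat \<Rightarrow> (real ^ 'n::finite) set \<Rightarrow> (real ^ 'n \<Rightarrow> real) \<Rightarrow> bool" where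
  "Ck_on 0 S u \<longleftrightarrow> continuous_on S u"
| "Ck_on (Suc k) S u \<longleftrightarrow>
     (\<forall>x\<in>S. u differentiable (at x)) \<and> (\<forall>i. Ck_on k S (partial_deriv i u))"

definition smooth_on :: "(real ^ 'n::finite) set \<Rightarrow> (real ^ 'n \<Rightarrow> real) \<Rightarrow> bool" where
  "smooth_on S u \<longleftrightarrow> (\<forall>k. Ck_on k S u)"

definition charpoly :: "real ^ 'n ^ 'n::finite \<Rightarrow> real poly" where
  "charpoly A = det (\<chi> i j. (if i = j then [:0, 1:] else 0) - [:A $ i $ j:])"

text \<open>The eigenvalues are counted with algebraic multiplicity. Only real ones appear; for the
  symmetric matrices considered here these are all \<open>CARD('n)\<close> of them.\<close>

definition eigenvalues :: "real ^ 'n ^ 'n::finite \<Rightarrow> real multiset" where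
  "eigenvalues A = proots (charpoly A)"

definition special_lagrangian_on ::
    "(real ^ 'n::finite) set \<Rightarrow> real \<Rightarrow> (real ^ 'n \<Rightarrow> real) \<Rightarrow> bool" where
  "special_lagrangian_on S \<Theta> u \<longleftrightarrow>
     (\<forall>x\<in>S. (\<Sum>\<mu>\<in>#eigenvalues (hessian u x). arctan \<mu>) = \<Theta>)"

text \<open>Extended real valued, so that an unbounded function has oscillation \<open>\<infinity>\<close>. For nonempty \<open>S\<close>
  the difference is never of the form \<open>\<infinity> - \<infinity>\<close>.\<close>

definition osc :: "'a set \<Rightarrow> ('a \<Rightarrow> real) \<Rightarrow> ereal" where
  "osc S v = (SUP x\<in>S. ereal (v x)) - (INF x\<in>S. ereal (v x))"

end

theory Submission
  imports Defs
begin

text \<open>Maximum principle for \<open>w = \<eta> \<bar>Du\<bar> + A (u + c)\<^sup>2\<close> on the ball \<open>B\<close> of radius \<open>R\<close> around a point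
  \<open>x\<^sub>0\<close>, with \<open>\<eta> = R\<^sup>2 - \<bar>x - x\<^sub>0\<bar>\<^sup>2\<close>, \<open>M = osc u + R\<close>, \<open>A = 2 n R / M\<close> and \<open>c\<close> such that
  \<open>M \<le> u + c \<le> 2 M\<close>. At an interior maximum one may replace \<open>\<bar>Du\<bar>\<close> by \<open>\<partial>\<^sub>e u\<close> with the fixed direction
  \<open>e = Du / \<bar>Du\<bar>\<close>, and \<open>\<partial>\<^sub>e u\<close> solves the linearized equation, whose coefficients in an eigenbasis of
  \<open>D\<^sup>2u\<close> are \<open>1 / (1 + \<mu>\<^sub>i\<^sup>2)\<close>. The first order condition forces \<open>\<mu>\<^sub>k < 0\<close> for an eigendirection \<open>k\<close>
  with \<open>e\<^sub>k\<^sup>2 \<ge> 1 / n\<close>. As \<open>\<Theta> \<ge> (n - 2) \<pi> / 2\<close> (the other sign is reduced to this by \<open>u \<mapsto> - u\<close>), any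
  two eigenvalues have nonnegative sum, so \<open>\<mu>\<^sub>k\<close> is the only negative one and carries the largest
  coefficient. The good term \<open>2 A \<bar>Du\<bar>\<^sup>2 e\<^sub>k\<^sup>2 / (1 + \<mu>\<^sub>k\<^sup>2)\<close> then dominates in the second order condition
  and yields \<open>\<eta> \<bar>Du\<bar> \<le> C(n) R M\<close>.\<close>

section \<open>Symmetric matrices\<close>

lemma symmetric_inner_matrix:
  fixes A :: "real ^ 'n ^ 'n"
  assumes "transpose A = A"
  shows "x \<bullet> (A *v y) = (A *v x) \<bullet> y"
  by (metis assms dot_lmul_matrix vector_transpose_matrix)

section \<open>Spectral theorem by maximizing the Rayleigh quotient\<close>

text \<open>First variation: along \<open>x + t y\<close> the maximality reads
  \<open>2 a t \<le> k t^2\<close> for every real \<open>t\<close>, which forces the linear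
  coefficient \<open>a\<close> to vanish. Only vectors in the span are tested, so the argument works
  inside an invariant subspace.\<close>

lemma rayleigh_maximizer_orthogonal:
  fixes A :: "real ^ 'n ^ 'n"
  assumes sym: "transpose A = A" and x: "norm x = 1" and y: "x \<bullet> y = 0"
    and max: "\<And>z. z \<in> span {x, y} \<Longrightarrow> z \<bullet> (A *v z) \<le> (x \<bullet> (A *v x)) * (z \<bullet> z)"
  shows "y \<bullet> (A *v x) = 0"
proof -
  define a where "a = y \<bullet> (A *v x)"
  define \<mu> where "\<mu> = x \<bullet> (A *v x)"
  define k where "k = \<mu> * (y \<bullet> y) - y \<bullet> (A *v y)"
  have xAy: "x \<bullet> (A *v y) = a"
    unfolding a_def by (metis symmetric_inner_matrix[OF sym] inner_commute)
  have xx: "x \<bullet> x = 1"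
    using x by (simp add: norm_eq_1)
  have ineq: "2 * a * t \<le> k * t\<^sup>2" for t
  proof -
    have "x + t *\<^sub>R y \<in> span {x, y}"
      by (intro span_add span_mul span_base) auto
    from max[OF this] show ?thesis
      using xx y xAy
      by (simp add: matrix_vector_right_distrib matrix_vector_mult_scaleR inner_simps inner_commute[of y x]
          k_def a_def[symmetric] \<mu>_def[symmetric] algebra_simps power2_eq_square)
  qed
  have "((\<lambda>t. k * t\<^sup>2 - 2 * a * t) has_real_derivative - 2 * a) (at 0)"
    by (auto intro!: derivative_eq_intros)
  from DERIV_local_min[OF this zero_less_one] have "a = 0"
    using ineq by simp
  then show ?thesis by (simp add: a_def)
qed

text \<open>Take a maximizer \<open>x\<close> of the quadratic form on the compact unit sphere of
  \<open>S\<close>. The residual \<open>y = A x - Q(x) x\<close> stays in \<open>S\<close> and is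
  orthogonal to \<open>x\<close>; the first variation makes it orthogonal to \<open>A x\<close> too,
  hence to itself.\<close>

lemma exists_eigenvector_in_subspace:
  fixes A :: "real ^ 'n ^ 'n"
  assumes sym: "transpose A = A" and S: "subspace S" "S \<noteq> {0}"
    and inv: "\<And>x. x \<in> S \<Longrightarrow> A *v x \<in> S"
  obtains x \<mu> where "x \<in> S" "norm x = 1" "A *v x = \<mu> *\<^sub>R x"
proof -
  let ?Q = "\<lambda>x. x \<bullet> (A *v x)"
  have "compact (S \<inter> sphere 0 1)"
    using S(1) closed_subspace by (intro closed_Int_compact) auto
  moreover obtain z where z: "z \<in> S" "z \<noteq> 0"
    using S subspace_0 by blast
  then have "z /\<^sub>R norm z \<in> S \<inter> sphere 0 1"
    using S(1) by (auto simp: subspace_scale)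
  moreover have "continuous_on (S \<inter> sphere 0 1) ?Q"
    by (intro continuous_intros matrix_vector_mult_linear_continuous_on)
  ultimately obtain x where x: "x \<in> S" "norm x = 1"
    and max: "\<And>y. y \<in> S \<inter> sphere 0 1 \<Longrightarrow> ?Q y \<le> ?Q x"
    using continuous_attains_sup[of "S \<inter> sphere 0 1" ?Q] by (metis IntE emptyE dist_0_norm mem_sphere)
  have max': "?Q y \<le> ?Q x * (y \<bullet> y)" if "y \<in> S" for y
  proof (cases "y = 0")
    case False
    have "?Q (y /\<^sub>R norm y) \<le> ?Q x"
      using that False S(1) by (intro max) (auto simp: subspace_scale)
    moreover have "?Q (y /\<^sub>R norm y) = ?Q y / (norm y)\<^sup>2"
      by (simp add: matrix_vector_mult_scaleR power2_eq_square divide_simps)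
    ultimately show ?thesis
      using False by (simp add: divide_le_eq power2_norm_eq_inner)
  qed simp
  define y where "y = A *v x - ?Q x *\<^sub>R x"
  have xx: "x \<bullet> x = 1"
    using x by (simp add: norm_eq_1)
  have xy: "x \<bullet> y = 0"
    using xx by (simp add: y_def inner_simps)
  have "y \<in> S"
    using x inv S(1) by (simp add: y_def subspace_diff subspace_scale)
  then have "span {x, y} \<subseteq> S"
    using x S(1) by (intro span_minimal) auto
  then have "y \<bullet> (A *v x) = 0"
    using x xy max' by (intro rayleigh_maximizer_orthogonal[OF sym]) auto
  then have "y \<bullet> y = 0"
    using xy by (subst (2) y_def) (simp add: inner_simps inner_commute)
  then show ?thesis
    using that[of x "?Q x"] x by (simp add: y_def)
qed

text \<open>Induction on the dimension: split off one unit eigenvector; by symmetry of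
  \<open>A\<close> its orthogonal complement in \<open>S\<close> is again invariant.\<close>

lemma orthonormal_eigenvectors_of_subspace:
  fixes A :: "real ^ 'n ^ 'n"
  assumes sym: "transpose A = A" and "subspace S" and "\<And>x. x \<in> S \<Longrightarrow> A *v x \<in> S"
  shows "\<exists>B. finite B \<and> B \<subseteq> S \<and> pairwise orthogonal B \<and> card B = dim S \<and>
    (\<forall>x\<in>B. norm x = 1 \<and> (\<exists>\<mu>. A *v x = \<mu> *\<^sub>R x))"
  using assms(2,3)
proof (induction "dim S" arbitrary: S)
  case 0
  then show ?case by (intro exI[of _ "{}"]) auto
next
  case (Suc k)
  then have "S \<noteq> {0}"
    by auto
  then obtain x \<mu> where x: "x \<in> S" "norm x = 1" "A *v x = \<mu> *\<^sub>R x"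
    using exists_eigenvector_in_subspace[OF sym Suc.prems(1) _ Suc.prems(2)] by metis
  define S' where "S' = {y \<in> S. orthogonal x y}"
  have span: "span {x} \<subseteq> S"
    using x Suc.prems(1) by (simp add: span_minimal)
  have S'_eq: "S' = {y \<in> S. \<forall>z \<in> span {x}. orthogonal z y}"
    by (auto simp: S'_def span_singleton orthogonal_def)
  have "dim S' + dim (span {x}) = dim S"
    unfolding S'_eq using Suc.prems(1) span by (intro dim_subspace_orthogonal_to_vectors) auto
  moreover have "dim {x} = 1"
    using x by (subst dim_eq_card_independent) auto
  ultimately have "k = dim S'"
    using Suc.hyps(2) by simp
  moreover have "subspace S'"
    using Suc.prems(1) by (auto simp: S'_def subspace_def orthogonal_clauses)
  moreover have "A *v y \<in> S'" if "y \<in> S'" for y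
    using that Suc.prems(2) x(3)
    by (auto simp: S'_def orthogonal_def symmetric_inner_matrix[OF sym])
  ultimately obtain B where B: "finite B" "B \<subseteq> S'" "pairwise orthogonal B" "card B = dim S'"
    "\<forall>x\<in>B. norm x = 1 \<and> (\<exists>\<mu>. A *v x = \<mu> *\<^sub>R x)"
    using Suc.hyps(1) by metis
  have "x \<notin> B"
    using B(2) x by (auto simp: S'_def orthogonal_self)
  moreover have "orthogonal x y" "orthogonal y x" if "y \<in> B" for y
    using B(2) that by (auto simp: S'_def orthogonal_commute)
  ultimately show ?case
    using B x \<open>k = dim S'\<close> Suc.hyps(2)
    by (intro exI[of _ "insert x B"]) (auto simp: pairwise_insert S'_def)
qed

text \<open>A family indexed by \<open>'n\<close> rather than a set: in \<open>real ^ 'n\<close> it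
  is automatically a basis, and eigenvalues become functions on the same index type, so
  multiplicities take care of themselves.\<close>

definition orthonormal :: "('n \<Rightarrow> 'a::real_inner) \<Rightarrow> bool" where
  "orthonormal b \<longleftrightarrow> (\<forall>i j. b i \<bullet> b j = (if i = j then 1 else 0))"

lemma symmetric_matrix_orthonormal_eigenbasis:
  fixes A :: "real ^ 'n ^ 'n"
  assumes "transpose A = A"
  obtains b :: "'n \<Rightarrow> real ^ 'n" and \<mu> where "orthonormal b" "\<And>i. A *v b i = \<mu> i *\<^sub>R b i"
proof -
  obtain B where B: "finite B" "pairwise orthogonal B" "card B = CARD('n)"
    "\<And>x. x \<in> B \<Longrightarrow> norm x = 1 \<and> (\<exists>\<mu>. A *v x = \<mu> *\<^sub>R x)"
    using orthonormal_eigenvectors_of_subspace[OF assms, of UNIV] by auto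
  obtain b :: "'n \<Rightarrow> real ^ 'n" where b: "bij_betw b UNIV B"
    using B(1,3) by (metis finite_class.finite_UNIV finite_same_card_bij)
  have "\<forall>i. \<exists>\<mu>. A *v b i = \<mu> *\<^sub>R b i"
    using B(4) b by (meson UNIV_I bij_betwE)
  then obtain \<mu> where "\<And>i. A *v b i = \<mu> i *\<^sub>R b i"
    by metis
  moreover have "orthonormal b"
    unfolding orthonormal_def
  proof (intro allI)
    fix i j
    have "b i \<in> B" "b j \<in> B" "b i = b j \<longleftrightarrow> i = j"
      using b by (auto simp: bij_betw_def inj_eq)
    then show "b i \<bullet> b j = (if i = j then 1 else 0)"
      using B(2,4) by (auto simp: norm_eq_1 pairwise_def orthogonal_def)
  qed
  ultimately show ?thesis
    using that by blast
qed

text \<open>The matrix with rows \<open>b i\<close> is orthogonal, so it preserves inner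
  products.\<close>

lemma orthonormal_parseval:
  fixes b :: "'n::finite \<Rightarrow> real ^ 'n"
  assumes "orthonormal b"
  shows "x \<bullet> y = (\<Sum>i\<in>UNIV. (x \<bullet> b i) * (b i \<bullet> y))"
proof -
  define P :: "real ^ 'n ^ 'n" where "P = (\<chi> i. b i)"
  have "orthogonal_matrix P"
    using assms by (auto simp: P_def orthogonal_matrix_orthonormal_rows row_def orthonormal_def
        norm_eq_1 orthogonal_def)
  then have "orthogonal_transformation ((*v) P)"
    by (simp add: orthogonal_transformation_matrix matrix_of_matrix_vector_mul)
  then have "x \<bullet> y = (P *v x) \<bullet> (P *v y)"
    by (simp add: orthogonal_transformation_def)
  also have "\<dots> = (\<Sum>i\<in>UNIV. (P *v x) $ i * (P *v y) $ i)"
    by (simp add: inner_vec_def)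
  also have "\<dots> = (\<Sum>i\<in>UNIV. (x \<bullet> b i) * (b i \<bullet> y))"
    by (simp add: matrix_vector_mul_component P_def inner_commute)
  finally show ?thesis .
qed

text \<open>The scalars \<open>c\<close>, \<open>d\<close> and the ring homomorphism \<open>h\<close> are kept general, so that this covers
  both the characteristic polynomial and the complex determinant of \<open>1 + \<i> A\<close>.\<close>

lemma det_pencil_orthonormal_basis:
  fixes h :: "real \<Rightarrow> 'a::comm_ring_1" and A :: "real ^ 'n ^ 'n" and b :: "'n \<Rightarrow> real ^ 'n"
  assumes b: "orthonormal b"
    and h: "h 0 = 0" "h 1 = 1" "\<And>x y. h (x + y) = h x + h y" "\<And>x y. h (x * y) = h x * h y"
  shows "det (\<chi> i j. c * (if i = j then 1 else 0) + d * h (A $ i $ j)) =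
    det (\<chi> i j. c * (if i = j then 1 else 0) + d * h (b i \<bullet> (A *v b j)))"
    (is "det ?M = det ?N")
proof -
  have h_sum: "h (sum f I) = (\<Sum>i\<in>I. h (f i))" for f :: "'n \<Rightarrow> real" and I
    by (induction I rule: infinite_finite_induct) (auto simp: h)
  define P :: "'a ^ 'n ^ 'n" where "P = (\<chi> i j. h (b i $ j))"
  have "(P ** transpose P) $ i $ j = h (b i \<bullet> b j)" for i j
    by (simp add: P_def matrix_matrix_mult_def transpose_def inner_vec_def h_sum h(4))
  then have "P ** transpose P = mat 1"
    using b by (simp add: vec_eq_iff mat_def orthonormal_def h(1,2))
  \<comment> \<open>Over a commutative ring the square of \<open>det P\<close> is all that
    conjugation by \<open>P\<close> requires.\<close>
  then have dd: "det P * det P = 1"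
    by (metis det_I det_mul det_transpose)
  have "?N = P ** ?M ** transpose P"
  proof -
    have "?N $ i $ j = (P ** ?M ** transpose P) $ i $ j" for i j
    proof -
      have "(P ** ?M ** transpose P) $ i $ j =
        (\<Sum>l\<in>UNIV. \<Sum>k\<in>UNIV. h (b i $ k) * (c * (if k = l then 1 else 0)) * h (b j $ l))
        + (\<Sum>l\<in>UNIV. \<Sum>k\<in>UNIV. h (b i $ k) * (d * h (A $ k $ l)) * h (b j $ l))"
        by (simp only: P_def matrix_matrix_mult_def transpose_def vec_lambda_beta sum_distrib_right
            distrib_left distrib_right sum.distrib)
      also have "(\<Sum>l\<in>UNIV. \<Sum>k\<in>UNIV. h (b i $ k) * (c * (if k = l then 1 else 0)) * h (b j $ l)) =
        (\<Sum>l\<in>UNIV. \<Sum>k\<in>UNIV. if k = l then c * h (b i $ l * b j $ l) else 0)"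
        by (intro sum.cong refl) (simp add: h(4) ac_simps)
      also have "\<dots> = c * h (b i \<bullet> b j)"
        by (simp add: sum_distrib_left h_sum inner_vec_def)
      also have "(\<Sum>l\<in>UNIV. \<Sum>k\<in>UNIV. h (b i $ k) * (d * h (A $ k $ l)) * h (b j $ l)) =
        d * h (b i \<bullet> (A *v b j))"
        unfolding inner_vec_def matrix_vector_mult_def inner_real_def vec_lambda_beta sum_distrib_left h_sum
        by (subst sum.swap) (simp only: h(4) ac_simps)
      finally show ?thesis
        using b by (simp add: orthonormal_def h)
    qed
    then show ?thesis
      by (simp add: vec_eq_iff)
  qed
  then have "det ?N = det P * det P * det ?M"
    by (simp add: det_mul ac_simps)
  with dd show ?thesis
    by simp
qed

lemma det_pencil_eigenbasis:
  fixes h :: "real \<Rightarrow> 'a::comm_ring_1" and A :: "real ^ 'n ^ 'n" and b :: "'n \<Rightarrow> real ^ 'n"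
  assumes b: "orthonormal b" and eig: "\<And>i. A *v b i = \<mu> i *\<^sub>R b i"
    and h: "h 0 = 0" "h 1 = 1" "\<And>x y. h (x + y) = h x + h y" "\<And>x y. h (x * y) = h x * h y"
  shows "det (\<chi> i j. c * (if i = j then 1 else 0) + d * h (A $ i $ j)) = (\<Prod>i\<in>UNIV. c + d * h (\<mu> i))"
  using b unfolding det_pencil_orthonormal_basis[OF b h]
  by (subst det_diagonal) (auto simp: eig orthonormal_def h)

text \<open>With \<open>c = X\<close> and \<open>d = -1\<close> the pencil is the characteristic
  matrix, so the characteristic polynomial splits into the factors \<open>X - \<mu> i\<close>. This
  ties the multiset in the equation to the indexed eigenvalues used below.\<close>

lemma eigenvalues_eigenbasis:
  fixes A :: "real ^ 'n ^ 'n" and b :: "'n \<Rightarrow> real ^ 'n"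
  assumes "orthonormal b" "\<And>i. A *v b i = \<mu> i *\<^sub>R b i"
  shows "eigenvalues A = image_mset \<mu> (mset_set UNIV)"
proof -
  have "(\<chi> i j. (if i = j then [:0, 1:] else 0) - [:A $ i $ j:]) =
      (\<chi> i j. [:0, 1:] * (if i = j then 1 else 0) + (- 1) * [:A $ i $ j:])"
    by (simp add: vec_eq_iff)
  then have "charpoly A = (\<Prod>i\<in>UNIV. [:- \<mu> i, 1:])"
    using det_pencil_eigenbasis[where h = "\<lambda>x. [:x:]" and c = "[:0, 1:]" and d = "-1", OF assms]
    by (simp add: charpoly_def)
  then show ?thesis
    by (simp add: eigenvalues_def proots_prod sum_unfold_sum_mset)
qed

text \<open>The argument of this determinant is the phase modulo \<open>2 pi\<close>. As a
  polynomial in the matrix entries it can be differentiated, whereas individual eigenvalues need not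
  be differentiable.\<close>

lemma det_one_plus_ii_eigenbasis:
  fixes A :: "real ^ 'n ^ 'n" and b :: "'n \<Rightarrow> real ^ 'n"
  assumes "orthonormal b" "\<And>i. A *v b i = \<mu> i *\<^sub>R b i"
  shows "det (\<chi> i j. (if i = j then 1 else 0) + \<i> * complex_of_real (A $ i $ j)) =
    (\<Prod>i\<in>UNIV. 1 + \<i> * complex_of_real (\<mu> i))"
  using det_pencil_eigenbasis[where h = complex_of_real and c = 1 and d = \<i>, OF assms]
  by simp

section \<open>The phase as the argument of a determinant\<close>

text \<open>In the Leibniz expansion a permutation other than the identity moves at least two
  indices. After one factor is differentiated, an off-diagonal one remains, and it vanishes at
  \<open>x\<close>.\<close>

lemma has_derivative_det_diagonal:
  fixes M :: "'n::finite \<Rightarrow> 'n \<Rightarrow> 'b::real_normed_vector \<Rightarrow> 'a::real_normed_field"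
  assumes M: "\<And>i j. (M i j has_derivative M' i j) (at x)"
    and diag: "\<And>i j. i \<noteq> j \<Longrightarrow> M i j x = 0"
  shows "((\<lambda>y. det (\<chi> i j. M i j y)) has_derivative
    (\<lambda>h. \<Sum>i\<in>UNIV. M' i i h * (\<Prod>j\<in>UNIV - {i}. M j j x))) (at x)"
proof -
  let ?P = "{p :: 'n \<Rightarrow> 'n. p permutes UNIV}"
  let ?D = "\<lambda>p h. of_int (sign p) * (\<Sum>i\<in>UNIV. M' i (p i) h * (\<Prod>j\<in>UNIV - {i}. M j (p j) x))"
  have "((\<lambda>y. \<Sum>p\<in>?P. of_int (sign p) * (\<Prod>i\<in>UNIV. M i (p i) y)) has_derivative
      (\<lambda>h. \<Sum>p\<in>?P. ?D p h)) (at x)"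
    by (intro has_derivative_sum has_derivative_mult_right has_derivative_prod M)
  moreover have "(\<Sum>p\<in>?P. ?D p h) = ?D id h" for h
  proof -
    have "?D p h = 0" if p: "p \<in> ?P" "p \<noteq> id" for p
    proof -
      have "(\<Prod>j\<in>UNIV - {i}. M j (p j) x) = 0" for i
      proof -
        have "inj p"
          using p by (auto dest: permutes_inj)
        then obtain j where "j \<noteq> i" "p j \<noteq> j"
          using p(2) by (metis eq_id_iff injD)
        then have "j \<in> UNIV - {i}" "M j (p j) x = 0"
          using diag by auto
        then show ?thesis
          by (intro prod_zero) auto
      qed
      then show ?thesis
        by (simp only: mult_zero_right sum.neutral_const)
    qed
    then have "(\<Sum>p\<in>?P. ?D p h) = (\<Sum>p\<in>{id}. ?D p h)"
      by (intro sum.mono_neutral_right finite_permutations) (auto intro: permutes_id)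
    then show ?thesis
      by simp
  qed
  ultimately show ?thesis
    by (simp add: det_def sign_id)
qed

lemma one_plus_ii_eq_cis_arctan:
  "1 + \<i> * complex_of_real x = complex_of_real (sqrt (1 + x\<^sup>2)) * cis (arctan x)"
proof -
  have "sqrt (1 + x\<^sup>2) \<noteq> 0"
    by (metis add_nonneg_eq_0_iff real_sqrt_eq_zero_cancel_iff zero_le_one zero_le_power2 zero_neq_one)
  then show ?thesis
    by (simp add: complex_eq_iff cos_arctan sin_arctan)
qed

text \<open>Each factor \<open>1 + i \<mu>\<close> has polar angle \<open>arctan \<mu>\<close>; the
  rotation cancels all angles and leaves the moduli.\<close>

lemma cis_minus_sum_arctan_times_prod:
  assumes "finite I"
  shows "cis (- (\<Sum>i\<in>I. arctan (\<mu> i))) * (\<Prod>i\<in>I. 1 + \<i> * complex_of_real (\<mu> i)) =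
    complex_of_real (\<Prod>i\<in>I. sqrt (1 + (\<mu> i)\<^sup>2))"
  using assms
proof (induction I)
  case (insert i I)
  have cis: "cis (- (\<Sum>i\<in>insert i I. arctan (\<mu> i))) = cis (- arctan (\<mu> i)) * cis (- (\<Sum>i\<in>I. arctan (\<mu> i)))"
    using insert by (simp add: cis_mult)
  have "cis (- (\<Sum>i\<in>insert i I. arctan (\<mu> i))) * (\<Prod>i\<in>insert i I. 1 + \<i> * complex_of_real (\<mu> i)) =
    (cis (- arctan (\<mu> i)) * (1 + \<i> * complex_of_real (\<mu> i))) *
    (cis (- (\<Sum>i\<in>I. arctan (\<mu> i))) * (\<Prod>i\<in>I. 1 + \<i> * complex_of_real (\<mu> i)))"
    by (simp only: cis prod.insert[OF insert.hyps] ac_simps)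
  also have "cis (- arctan (\<mu> i)) * (1 + \<i> * complex_of_real (\<mu> i)) = complex_of_real (sqrt (1 + (\<mu> i)\<^sup>2))"
    by (simp add: one_plus_ii_eq_cis_arctan cis_mult mult.left_commute)
  finally show ?case
    using insert by simp
qed simp

text \<open>The derivative of the determinant at a diagonal matrix only sees the diagonal, and
  \<open>e\<^sup>-\<^sup>i\<^sup>\<Theta> det (1 + i a)\<close> is a positive real number at \<open>t = 0\<close>.\<close>

lemma linearized_phase_equation:
  fixes a :: "'n::finite \<Rightarrow> 'n \<Rightarrow> real \<Rightarrow> real"
  assumes a: "\<And>i j. (a i j has_real_derivative a' i j) (at 0)"
    and diag: "\<And>i j. a i j 0 = (if i = j then \<mu> i else 0)"
    and \<Theta>: "(\<Sum>i\<in>UNIV. arctan (\<mu> i)) = \<Theta>"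
    and real: "eventually (\<lambda>t. Im (cis (- \<Theta>) *
      det (\<chi> i j. (if i = j then 1 else 0) + \<i> * complex_of_real (a i j t))) = 0) (at 0)"
  shows "(\<Sum>i\<in>UNIV. a' i i / (1 + (\<mu> i)\<^sup>2)) = 0"
proof -
  let ?Z = "\<lambda>t. cis (- \<Theta>) * det (\<chi> i j. (if i = j then 1 else 0) + \<i> * complex_of_real (a i j t))"
  let ?f = "\<lambda>i. 1 + \<i> * complex_of_real (\<mu> i)"
  let ?q = "\<Prod>i\<in>UNIV. sqrt (1 + (\<mu> i)\<^sup>2)"
  have f: "?f i \<noteq> 0" for i
    by (simp add: complex_eq_iff)
  have "((\<lambda>t. (if i = j then 1 else 0) + \<i> * complex_of_real (a i j t)) has_derivative
    (\<lambda>h. \<i> * complex_of_real (a' i j * h))) (at 0)" for i j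
    using a[of i j] unfolding has_field_derivative_def
    by (auto intro!: derivative_eq_intros)
  then have D: "((\<lambda>t. det (\<chi> i j. (if i = j then 1 else 0) + \<i> * complex_of_real (a i j t))) has_derivative
    (\<lambda>h. \<Sum>i\<in>UNIV. \<i> * complex_of_real (a' i i * h) *
      (\<Prod>j\<in>UNIV - {i}. (if j = j then 1 else 0) + \<i> * complex_of_real (a j j 0)))) (at 0)"
    by (rule has_derivative_det_diagonal) (simp add: diag)
  \<comment> \<open>Logarithmic derivative: pulling out the full product divides each term by its
    own factor.\<close>
  have *: "\<i> * complex_of_real (a' i i * h) * (\<Prod>j\<in>UNIV - {i}. ?f j) =
      (\<Prod>j\<in>UNIV. ?f j) * (\<i> * complex_of_real (a' i i * h) / ?f i)" for i h
    using f[of i] by (subst prod.remove[of UNIV i]) auto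
  from D have "(?Z has_derivative
    (\<lambda>h. cis (- \<Theta>) * (\<Sum>i\<in>UNIV. \<i> * complex_of_real (a' i i * h) * (\<Prod>j\<in>UNIV - {i}. ?f j)))) (at 0)"
    by (intro has_derivative_mult_right) (simp add: diag)
  also have "(\<lambda>h. cis (- \<Theta>) * (\<Sum>i\<in>UNIV. \<i> * complex_of_real (a' i i * h) * (\<Prod>j\<in>UNIV - {i}. ?f j))) =
    (\<lambda>h. (cis (- \<Theta>) * (\<Prod>j\<in>UNIV. ?f j)) * (\<Sum>i\<in>UNIV. \<i> * complex_of_real (a' i i * h) / ?f i))"
    unfolding * by (simp only: sum_distrib_left mult.assoc)
  also have "cis (- \<Theta>) * (\<Prod>j\<in>UNIV. ?f j) = complex_of_real ?q"
    unfolding \<Theta>[symmetric] by (rule cis_minus_sum_arctan_times_prod) simp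
  finally have "((\<lambda>t. Im (?Z t)) has_derivative
    (\<lambda>h. Im (complex_of_real ?q * (\<Sum>i\<in>UNIV. \<i> * complex_of_real (a' i i * h) / ?f i)))) (at 0)"
    by (rule bounded_linear.has_derivative[OF bounded_linear_Im])
  also have "(\<lambda>h. Im (complex_of_real ?q * (\<Sum>i\<in>UNIV. \<i> * complex_of_real (a' i i * h) / ?f i))) =
    (\<lambda>h. ?q * (\<Sum>i\<in>UNIV. a' i i / (1 + (\<mu> i)\<^sup>2)) * h)"
  proof
    fix h
    have "Im (complex_of_real ?q * z) = ?q * Im z" for z
      by (simp only: Im_complex_of_real Re_complex_of_real times_complex.simps)
    \<comment> \<open>This is where the coefficients \<open>1 / (1 + \<mu>^2)\<close> of the
      linearized equation arise.\<close>
    moreover have "Im (\<i> * complex_of_real (a' i i * h) / ?f i) = a' i i / (1 + (\<mu> i)\<^sup>2) * h" for i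
      by (simp add: Im_divide power2_eq_square)
    ultimately show "Im (complex_of_real ?q * (\<Sum>i\<in>UNIV. \<i> * complex_of_real (a' i i * h) / ?f i)) =
      ?q * (\<Sum>i\<in>UNIV. a' i i / (1 + (\<mu> i)\<^sup>2)) * h"
      by (simp only: Im_sum sum_distrib_right mult.assoc)
  qed
  finally have "((\<lambda>t. Im (?Z t)) has_derivative
    (\<lambda>h. ?q * (\<Sum>i\<in>UNIV. a' i i / (1 + (\<mu> i)\<^sup>2)) * h)) (at 0)" .
  then have "((\<lambda>t. Im (?Z t)) has_real_derivative ?q * (\<Sum>i\<in>UNIV. a' i i / (1 + (\<mu> i)\<^sup>2))) (at 0)"
    by (simp add: has_field_derivative_def)
  moreover have "((\<lambda>t. Im (?Z t)) has_real_derivative 0) (at 0)"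
  proof -
    \<comment> \<open>\<open>real\<close> speaks of a punctured neighbourhood; the value at 0 is
      real by direct computation, so the imaginary part vanishes on a full neighbourhood.\<close>
    have "?Z 0 = complex_of_real ?q"
      using cis_minus_sum_arctan_times_prod[of UNIV \<mu>] \<Theta> by (subst det_diagonal) (auto simp: diag)
    then have "Im (?Z 0) = 0"
      by (simp only: Im_complex_of_real)
    then have "eventually (\<lambda>t. Im (?Z t) = 0) (nhds 0)"
      unfolding eventually_nhds_conv_at by (intro conjI real)
    then show ?thesis
      by (subst DERIV_cong_ev[OF refl _ refl, where g = "\<lambda>_. 0"]) auto
  qed
  ultimately have "?q * (\<Sum>i\<in>UNIV. a' i i / (1 + (\<mu> i)\<^sup>2)) = 0"
    by (rule DERIV_unique)
  moreover have "?q \<noteq> 0"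
    by (intro less_imp_neq[THEN not_sym] prod_pos) (auto intro: add_pos_nonneg)
  ultimately show ?thesis
    by (blast dest: mult_eq_0_iff[THEN iffD1])
qed

text \<open>The other \<open>n - 2\<close> arctangents contribute at most
  \<open>(n - 2) pi / 2\<close>, so those of the pair have nonnegative sum; oddness and monotonicity
  of \<open>arctan\<close> finish.\<close>

lemma supercritical_pair_nonneg:
  fixes \<mu> :: "'n::finite \<Rightarrow> real"
  assumes "(\<Sum>i\<in>UNIV. arctan (\<mu> i)) \<ge> (real CARD('n) - 2) * (pi / 2)" and "i \<noteq> j"
  shows "\<mu> i + \<mu> j \<ge> 0"
proof -
  have "(\<Sum>k\<in>UNIV. arctan (\<mu> k)) = arctan (\<mu> i) + (arctan (\<mu> j) + (\<Sum>k\<in>UNIV - {i} - {j}. arctan (\<mu> k)))"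
    using assms(2) by (simp add: sum.remove[of UNIV i] sum.remove[of "UNIV - {i}" j])
  also have "(\<Sum>k\<in>UNIV - {i} - {j}. arctan (\<mu> k)) \<le> (\<Sum>k\<in>UNIV - {i} - {j}. pi / 2)"
    by (intro sum_mono less_imp_le arctan_ubound)
  also have "\<dots> = (real CARD('n) - 2) * (pi / 2)"
  proof -
    have "{i, j} \<subseteq> (UNIV :: 'n set)" "card {i, j} = 2"
      using assms(2) by auto
    then have "2 \<le> CARD('n)"
      by (metis card_mono finite)
    moreover have "card (UNIV - {i} - {j}) = CARD('n) - 2"
      using assms(2) by (simp add: card_Diff_singleton_if)
    ultimately show ?thesis
      by (simp add: of_nat_diff)
  qed
  finally have "arctan (- \<mu> j) \<le> arctan (\<mu> i)"
    using assms(1) by (simp add: arctan_minus)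
  then show ?thesis
    by (simp add: arctan_le_iff)
qed

section \<open>Symmetry of second derivatives\<close>

lemma has_real_derivative_along_line:
  fixes f :: "'a::real_normed_vector \<Rightarrow> real"
  assumes "((\<lambda>s. f (y + t *\<^sub>R a + s *\<^sub>R a)) has_real_derivative D) (at 0)"
  shows "((\<lambda>s. f (y + s *\<^sub>R a)) has_real_derivative D) (at t)"
  using assms DERIV_shift[of "\<lambda>s. f (y + s *\<^sub>R a)" D 0 t] by (simp add: algebra_simps)

text \<open>Mean value theorem twice: in direction \<open>a\<close> for the increment of
  \<open>f\<close> by \<open>s b\<close>, then in direction \<open>b\<close> for
  \<open>fa\<close>.\<close>

lemma second_difference_mean_value:
  fixes f :: "'a::real_normed_vector \<Rightarrow> real"
  assumes fa: "\<And>y. y \<in> S \<Longrightarrow> ((\<lambda>t. f (y + t *\<^sub>R a)) has_real_derivative fa y) (at 0)"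
    and fab: "\<And>y. y \<in> S \<Longrightarrow> ((\<lambda>t. fa (y + t *\<^sub>R b)) has_real_derivative fab y) (at 0)"
    and s: "0 < s" and S: "\<And>p q. 0 \<le> p \<Longrightarrow> p \<le> s \<Longrightarrow> 0 \<le> q \<Longrightarrow> q \<le> s \<Longrightarrow> x + p *\<^sub>R a + q *\<^sub>R b \<in> S"
  shows "\<exists>p q. 0 < p \<and> p < s \<and> 0 < q \<and> q < s \<and>
    f (x + s *\<^sub>R a + s *\<^sub>R b) - f (x + s *\<^sub>R a) - f (x + s *\<^sub>R b) + f x =
      s * s * fab (x + p *\<^sub>R a + q *\<^sub>R b)"
proof -
  have *: "((\<lambda>t. f (x + s *\<^sub>R b + t *\<^sub>R a) - f (x + t *\<^sub>R a)) has_real_derivative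
    fa (x + p *\<^sub>R a + s *\<^sub>R b) - fa (x + p *\<^sub>R a)) (at p)" if "0 \<le> p" "p \<le> s" for p
  proof (rule DERIV_diff; rule has_real_derivative_along_line)
    have swap: "x + s *\<^sub>R b + p *\<^sub>R a = x + p *\<^sub>R a + s *\<^sub>R b"
      by simp
    show "((\<lambda>t. f (x + s *\<^sub>R b + p *\<^sub>R a + t *\<^sub>R a)) has_real_derivative fa (x + p *\<^sub>R a + s *\<^sub>R b)) (at 0)"
      unfolding swap using fa[OF S[of p s]] that s by simp
    show "((\<lambda>t. f (x + p *\<^sub>R a + t *\<^sub>R a)) has_real_derivative fa (x + p *\<^sub>R a)) (at 0)"
      using fa[OF S[of p 0]] that s by simp
  qed
  obtain p where p: "0 < p" "p < s"
    and 1: "(f (x + s *\<^sub>R b + s *\<^sub>R a) - f (x + s *\<^sub>R a)) - (f (x + s *\<^sub>R b + 0 *\<^sub>R a) - f (x + 0 *\<^sub>R a)) =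
      (s - 0) * (fa (x + p *\<^sub>R a + s *\<^sub>R b) - fa (x + p *\<^sub>R a))"
    using MVT2[OF s *] by blast
  have "((\<lambda>t. fa (x + p *\<^sub>R a + t *\<^sub>R b)) has_real_derivative fab (x + p *\<^sub>R a + q *\<^sub>R b)) (at q)"
    if "0 \<le> q" "q \<le> s" for q
    using that p by (intro has_real_derivative_along_line[OF fab] S) auto
  from MVT2[OF s this] obtain q where q: "0 < q" "q < s"
    and 2: "fa (x + p *\<^sub>R a + s *\<^sub>R b) - fa (x + p *\<^sub>R a + 0 *\<^sub>R b) = (s - 0) * fab (x + p *\<^sub>R a + q *\<^sub>R b)"
    by blast
  show ?thesis
  proof (intro exI conjI)
    have swap: "x + s *\<^sub>R b + s *\<^sub>R a = x + s *\<^sub>R a + s *\<^sub>R b"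
      by simp
    show "f (x + s *\<^sub>R a + s *\<^sub>R b) - f (x + s *\<^sub>R a) - f (x + s *\<^sub>R b) + f x =
      s * s * fab (x + p *\<^sub>R a + q *\<^sub>R b)"
      using 1 2 unfolding swap by simp
  qed (use p q in auto)
qed

text \<open>The second difference is symmetric in \<open>a\<close> and \<open>b\<close>, so the two
  mixed derivatives agree at suitable points of an arbitrarily small parallelogram; continuity
  transfers this to \<open>x\<close>.\<close>

lemma mixed_directional_derivatives_commute:
  fixes f :: "'a::real_normed_vector \<Rightarrow> real"
  assumes S: "open S" "x \<in> S"
    and fa: "\<And>y. y \<in> S \<Longrightarrow> ((\<lambda>t. f (y + t *\<^sub>R a)) has_real_derivative fa y) (at 0)"
    and fb: "\<And>y. y \<in> S \<Longrightarrow> ((\<lambda>t. f (y + t *\<^sub>R b)) has_real_derivative fb y) (at 0)"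
    and fab: "\<And>y. y \<in> S \<Longrightarrow> ((\<lambda>t. fa (y + t *\<^sub>R b)) has_real_derivative fab y) (at 0)"
    and fba: "\<And>y. y \<in> S \<Longrightarrow> ((\<lambda>t. fb (y + t *\<^sub>R a)) has_real_derivative fba y) (at 0)"
    and cont: "isCont fab x" "isCont fba x"
  shows "fab x = fba x"
proof (rule ccontr)
  assume ne: "fab x \<noteq> fba x"
  define e where "e = \<bar>fab x - fba x\<bar> / 2"
  have e: "e > 0"
    using ne by (simp add: e_def)
  have "(fab \<longlongrightarrow> fab x) (nhds x)" "(fba \<longlongrightarrow> fba x) (nhds x)"
    using cont by (simp_all add: isCont_def tendsto_at_iff_tendsto_nhds)
  note this[THEN tendstoD, OF e, unfolded dist_real_def]
  then have "eventually (\<lambda>y. y \<in> S \<and> \<bar>fab y - fab x\<bar> < e \<and> \<bar>fba y - fba x\<bar> < e) (nhds x)"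
    using S by (intro eventually_conj eventually_nhds_in_open)
  then obtain d where d: "d > 0"
    "\<And>y. dist y x < d \<Longrightarrow> y \<in> S \<and> \<bar>fab y - fab x\<bar> < e \<and> \<bar>fba y - fba x\<bar> < e"
    by (auto simp: eventually_nhds_metric)
  \<comment> \<open>Keeps the whole parallelogram within distance \<open>d\<close> of
    \<open>x\<close>; the summand 1 covers \<open>a = b = 0\<close>.\<close>
  define s where "s = d / (norm a + norm b + 1)"
  have s: "s > 0"
    using d by (simp add: s_def add_nonneg_pos)
  have near: "dist (x + p *\<^sub>R a + q *\<^sub>R b) x < d" if "0 \<le> p" "p \<le> s" "0 \<le> q" "q \<le> s" for p q
  proof -
    have "dist (x + p *\<^sub>R a + q *\<^sub>R b) x \<le> p * norm a + q * norm b"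
      using norm_triangle_ineq[of "p *\<^sub>R a" "q *\<^sub>R b"] that by (simp add: dist_norm)
    also have "\<dots> \<le> s * norm a + s * norm b"
      using that by (intro add_mono mult_right_mono) auto
    also have "\<dots> < s * (norm a + norm b + 1)"
      using s by (simp add: algebra_simps)
    also have "\<dots> = d"
      using add_nonneg_pos[of "norm a + norm b" 1] by (simp add: s_def)
    finally show ?thesis .
  qed
  have near': "dist (x + p *\<^sub>R b + q *\<^sub>R a) x < d" if "0 \<le> p" "p \<le> s" "0 \<le> q" "q \<le> s" for p q
    using near[of q p] that by (simp add: ac_simps)
  obtain p q where pq: "0 < p" "p < s" "0 < q" "q < s"
    and 1: "f (x + s *\<^sub>R a + s *\<^sub>R b) - f (x + s *\<^sub>R a) - f (x + s *\<^sub>R b) + f x =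
      s * s * fab (x + p *\<^sub>R a + q *\<^sub>R b)"
    using second_difference_mean_value[of S f a fa b fab s x, OF fa fab s] d(2) near by blast
  obtain p' q' where pq': "0 < p'" "p' < s" "0 < q'" "q' < s"
    and 2: "f (x + s *\<^sub>R b + s *\<^sub>R a) - f (x + s *\<^sub>R b) - f (x + s *\<^sub>R a) + f x =
      s * s * fba (x + p' *\<^sub>R b + q' *\<^sub>R a)"
    using second_difference_mean_value[of S f b fb a fba s x, OF fb fba s] d(2) near' by blast
  have "s * s * fab (x + p *\<^sub>R a + q *\<^sub>R b) = s * s * fba (x + p' *\<^sub>R b + q' *\<^sub>R a)"
  proof -
    have swap: "x + s *\<^sub>R b + s *\<^sub>R a = x + s *\<^sub>R a + s *\<^sub>R b"
      by simp
    show ?thesis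
      using 1 2 unfolding swap by linarith
  qed
  then have "fab (x + p *\<^sub>R a + q *\<^sub>R b) = fba (x + p' *\<^sub>R b + q' *\<^sub>R a)"
    using s by simp
  moreover have "\<bar>fab (x + p *\<^sub>R a + q *\<^sub>R b) - fab x\<bar> < e" "\<bar>fba (x + p' *\<^sub>R b + q' *\<^sub>R a) - fba x\<bar> < e"
    using d(2)[OF near[of p q]] d(2)[OF near'[of p' q']] pq pq' by auto
  ultimately have "\<bar>fab x - fba x\<bar> < e + e"
    by linarith
  then show False
    by (simp add: e_def)
qed

section \<open>Gradients and partial derivatives\<close>

lemma has_derivative_gradient:
  fixes f :: "real ^ 'n \<Rightarrow> real"
  assumes "f differentiable (at x)"
  shows "(f has_derivative (\<lambda>h. gradient f x \<bullet> h)) (at x)"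
proof -
  have "(f has_derivative frechet_derivative f (at x)) (at x)"
    using assms by (simp add: frechet_derivative_works[symmetric])
  moreover have "frechet_derivative f (at x) h = gradient f x \<bullet> h" for h
  proof -
    interpret linear "frechet_derivative f (at x)"
      using assms by (rule linear_frechet_derivative)
    have "frechet_derivative f (at x) (\<Sum>i\<in>UNIV. (h $ i) *\<^sub>R axis i 1) = gradient f x \<bullet> h"
      by (simp add: sum scale inner_vec_def gradient_def partial_deriv_def ac_simps)
    moreover have "(\<Sum>i\<in>UNIV. (h $ i) *\<^sub>R axis i 1) = h"
      using basis_expansion[of h] by (simp add: scalar_mult_eq_scaleR)
    ultimately show ?thesis by simp
  qed
  then have "frechet_derivative f (at x) = (\<lambda>h. gradient f x \<bullet> h)"
    by (rule ext)
  ultimately show ?thesis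
    by (simp only:)
qed

lemma has_real_derivative_partial_deriv:
  fixes f :: "real ^ 'n \<Rightarrow> real"
  assumes "f differentiable (at x)"
  shows "((\<lambda>t. f (x + t *\<^sub>R axis i 1)) has_real_derivative partial_deriv i f x) (at 0)"
proof -
  have "(f has_derivative (\<lambda>h. gradient f x \<bullet> h)) (at (x + 0 *\<^sub>R axis i 1))"
    using has_derivative_gradient[OF assms] by simp
  moreover have "((\<lambda>t. x + t *\<^sub>R axis i 1) has_derivative (\<lambda>t. t *\<^sub>R axis i 1)) (at 0)"
    by (auto intro!: derivative_eq_intros)
  ultimately have "((\<lambda>t. f (x + t *\<^sub>R axis i 1)) has_derivative (\<lambda>t. gradient f x \<bullet> (t *\<^sub>R axis i 1))) (at 0)"
    by (rule has_derivative_compose[rotated])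
  then show ?thesis
    by (simp add: has_field_derivative_def inner_axis gradient_def mult_commute_abs)
qed

lemma partial_deriv_commute:
  fixes f :: "real ^ 'n \<Rightarrow> real"
  assumes "open S" "x \<in> S" "Ck_on 2 S f"
  shows "partial_deriv i (partial_deriv j f) x = partial_deriv j (partial_deriv i f) x"
proof -
  have "\<And>y. y \<in> S \<Longrightarrow> f differentiable (at y)"
    "\<And>y i. y \<in> S \<Longrightarrow> partial_deriv i f differentiable (at y)"
    and "\<And>i j. continuous_on S (partial_deriv i (partial_deriv j f))"
    using assms(3) by (auto simp: numeral_2_eq_2)
  moreover from this(3) have "isCont (partial_deriv i (partial_deriv j f)) x" for i j
    using assms(1,2) continuous_on_eq_continuous_at by blast
  ultimately show ?thesis
    by (intro mixed_directional_derivatives_commute[OF assms(1,2), where f = f and a = "axis j 1"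
          and b = "axis i 1" and fa = "partial_deriv j f" and fb = "partial_deriv i f"] has_real_derivative_partial_deriv) auto
qed

section \<open>The maximum principle\<close>

text \<open>If \<open>D\<close> were positive, \<open>\<phi>'\<close> would be positive just to the
  right of its zero at 0, and the mean value theorem would give values above the maximum.\<close>

lemma second_derivative_local_max:
  fixes \<phi> \<phi>' :: "real \<Rightarrow> real"
  assumes d: "d > 0" and \<phi>: "\<And>t. \<bar>t\<bar> < d \<Longrightarrow> (\<phi> has_real_derivative \<phi>' t) (at t)"
    and D: "(\<phi>' has_real_derivative D) (at 0)" and max: "\<And>t. \<bar>t\<bar> < d \<Longrightarrow> \<phi> t \<le> \<phi> 0"
  shows "\<phi>' 0 = 0" and "D \<le> 0"
proof -
  show 0: "\<phi>' 0 = 0"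
    using DERIV_local_max[OF \<phi> d] d max by simp
  show "D \<le> 0"
  proof (rule ccontr)
    assume "\<not> D \<le> 0"
    then obtain r where r: "r > 0" "\<And>h. 0 < h \<Longrightarrow> h < r \<Longrightarrow> \<phi>' 0 < \<phi>' (0 + h)"
      using DERIV_pos_inc_right[OF D] by force
    define t where "t = min r d / 2"
    have t: "0 < t" "t < r" "t < d"
      using r(1) d by (auto simp: t_def)
    obtain z where z: "0 < z" "z < t" "\<phi> t - \<phi> 0 = (t - 0) * \<phi>' z"
      using MVT2[OF t(1), of \<phi> \<phi>'] \<phi> t by force
    then have "\<phi> t - \<phi> 0 > 0"
      using r(2)[of z] 0 t by simp
    then show False
      using max[of t] t by simp
  qed
qed

text \<open>The pointwise computation at an interior maximum of \<open>\<eta> \<partial>\<^sub>e u + A u\<^sup>2\<close> in an eigenbasis of the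
  Hessian: \<open>u\<close> is the shifted value in \<open>[M, 2 M]\<close>, \<open>\<mu>\<close> are the eigenvalues, \<open>c\<close> the coordinates of \<open>e = Du / \<bar>Du\<bar>\<close>, \<open>p = \<bar>Du\<bar>\<close>, \<open>h\<close> the
  derivatives of the cutoff \<open>\<eta>\<close> and \<open>q\<close> the second derivatives of \<open>\<partial>\<^sub>e u\<close>. The choice of \<open>A\<close> makes
  the eigenvalue in the direction of the largest \<open>\<bar>c i\<bar>\<close> negative; by the phase condition it is
  then the smallest one in absolute value.\<close>

lemma interior_maximum_bound:
  fixes \<mu> c h q :: "'n::finite \<Rightarrow> real"
  defines "n \<equiv> real CARD('n)"
  assumes pos: "p > 0" "R > 0" "M > 0" "\<eta> > 0" "\<eta> \<le> R\<^sup>2"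
    and h: "\<And>i. \<bar>h i\<bar> \<le> 2 * R" and c: "(\<Sum>i\<in>UNIV. (c i)\<^sup>2) = 1"
    and u: "M \<le> u" "u \<le> 2 * M" and A: "A = 2 * n * R / M"
    and first: "\<And>i. h i * p + \<eta> * (\<mu> i * c i) + 2 * A * u * (p * c i) = 0"
    and second: "\<And>i. - 2 * p + 2 * h i * (\<mu> i * c i) + \<eta> * q i + 2 * A * (p * c i)\<^sup>2 + 2 * A * u * \<mu> i \<le> 0"
    and lin: "(\<Sum>i\<in>UNIV. q i / (1 + (\<mu> i)\<^sup>2)) = 0"
    and phase: "\<And>i j. i \<noteq> j \<Longrightarrow> \<mu> i + \<mu> j \<ge> 0"
  shows "\<eta> * p \<le> 31 * n\<^sup>2 * R * M"
proof -
  have n: "n \<ge> 1"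
    by (simp add: n_def Suc_leI)
  \<comment> \<open>The squares sum to 1, so one of them is at least their mean.\<close>
  have "\<exists>k. (c k)\<^sup>2 \<ge> 1 / n"
  proof (rule ccontr)
    assume "\<not> ?thesis"
    then have "(\<Sum>i\<in>UNIV. (c i)\<^sup>2) < (\<Sum>i\<in>(UNIV :: 'n set). 1 / n)"
      by (intro sum_strict_mono) (auto simp: not_le)
    with c n show False
      by (simp add: n_def)
  qed
  then obtain k where k: "1 / n \<le> (c k)\<^sup>2" ..
  have c1: "\<bar>c i\<bar> \<le> 1" for i
  proof -
    have "(c i)\<^sup>2 \<le> (\<Sum>i\<in>UNIV. (c i)\<^sup>2)"
      by (rule member_le_sum) auto
    with c show ?thesis
      by (simp add: abs_square_le_1)
  qed
  have "(c k)\<^sup>2 \<le> \<bar>c k\<bar>"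
    using c1[of k] mult_left_le_one_le[of "\<bar>c k\<bar>" "\<bar>c k\<bar>"] by (simp add: power2_eq_square abs_mult_self_eq)
  then have "n * (c k)\<^sup>2 \<le> n * \<bar>c k\<bar>"
    using n by (intro mult_left_mono) auto
  moreover have "1 \<le> n * (c k)\<^sup>2"
    using k n by (simp add: field_simps)
  ultimately have ck: "1 \<le> n * \<bar>c k\<bar>"
    by (rule order_trans[rotated])
  \<comment> \<open>The choice of \<open>A\<close> and the range of \<open>u\<close> pin
    \<open>A * u\<close> to the scale \<open>n R\<close>.\<close>
  have Au: "2 * n * R \<le> A * u" "A * u \<le> 4 * n * R"
    using u pos n by (auto simp: A field_simps mult_left_mono)
  have Au': "2 * (2 * n * R) \<le> 2 * (A * u)" "2 * (A * u) \<le> 8 * n * R"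
    using Au by linarith+
  have nR: "0 \<le> 8 * n * R"
    using n pos by simp
  have A_pos: "A > 0"
    using pos n by (simp add: A)
  have first_abs: "\<eta> * \<bar>\<mu> i * c i\<bar> = p * \<bar>h i + 2 * (A * u) * c i\<bar>" for i
  proof -
    have "\<eta> * (\<mu> i * c i) = - (p * (h i + 2 * (A * u) * c i))"
      using first[of i] by (simp add: algebra_simps)
    then have "\<bar>\<eta> * (\<mu> i * c i)\<bar> = \<bar>p * (h i + 2 * (A * u) * c i)\<bar>"
      by simp
    then show ?thesis
      using pos by (simp add: abs_mult)
  qed
  \<comment> \<open>The first order condition times \<open>c k\<close>: the cutoff contributes at
    most \<open>2 R |c k|\<close>, which \<open>2 A u (c k)^2 \<ge> 4 n R (c k)^2\<close> exceeds
    because \<open>n |c k| \<ge> 1\<close>.\<close>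
  have "\<eta> * \<mu> k * (c k)\<^sup>2 = - p * (h k * c k + 2 * (A * u) * (c k)\<^sup>2)"
    using arg_cong[OF first[of k], of "\<lambda>x. x * c k"] by (simp add: algebra_simps power2_eq_square)
  also have "\<dots> < 0"
  proof -
    have "\<bar>h k * c k\<bar> \<le> 2 * R * \<bar>c k\<bar>"
      using h[of k] by (simp add: abs_mult mult_right_mono)
    also have "\<dots> < 2 * (2 * n * R) * \<bar>c k\<bar> * \<bar>c k\<bar>"
    proof -
      have "0 < \<bar>c k\<bar>"
        using ck by (cases "c k = 0") auto
      have "1 < 2 * (n * \<bar>c k\<bar>)"
        using ck by simp
      then have "(2 * R * \<bar>c k\<bar>) * 1 < (2 * R * \<bar>c k\<bar>) * (2 * (n * \<bar>c k\<bar>))"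
        using pos(2) \<open>0 < \<bar>c k\<bar>\<close> by (intro mult_strict_left_mono) auto
      then show ?thesis
        by (simp add: ac_simps)
    qed
    also have "\<dots> = 2 * (2 * n * R) * (c k)\<^sup>2"
      by (simp add: power2_eq_square)
    also have "\<dots> \<le> 2 * (A * u) * (c k)\<^sup>2"
      by (intro mult_right_mono Au') auto
    finally have "h k * c k + 2 * (A * u) * (c k)\<^sup>2 > 0"
      by linarith
    then show ?thesis
      using pos(1) by simp
  qed
  finally have \<mu>k: "\<mu> k < 0"
    using pos(4) by (simp add: mult_less_0_iff)
  have \<mu>_other: "\<mu> i \<ge> - \<mu> k" if "i \<noteq> k" for i
    using phase[OF that] by simp
  \<comment> \<open>The first order condition divided by \<open>|c k|\<close>; the cutoff term
    \<open>2 R\<close> is absorbed by \<open>1 \<le> n |c k|\<close>, so 10 is 2 + 8.\<close>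
  have \<eta>\<mu>: "\<eta> * \<bar>\<mu> k\<bar> \<le> 10 * n * R * p"
  proof -
    have "(\<eta> * \<bar>\<mu> k\<bar>) * \<bar>c k\<bar> = p * \<bar>h k + 2 * (A * u) * c k\<bar>"
      using first_abs[of k] by (simp add: abs_mult mult.assoc)
    also have "\<dots> \<le> p * (2 * R + 8 * n * R * \<bar>c k\<bar>)"
    proof -
      have "\<bar>2 * (A * u) * c k\<bar> = 2 * (A * u) * \<bar>c k\<bar>"
        using A_pos u pos by (simp add: abs_mult)
      also have "\<dots> \<le> 8 * n * R * \<bar>c k\<bar>"
        by (intro mult_right_mono Au') auto
      finally have "\<bar>h k + 2 * (A * u) * c k\<bar> \<le> 2 * R + 8 * n * R * \<bar>c k\<bar>"
        using h[of k] by linarith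
      then show ?thesis
        using pos(1) by simp
    qed
    also have "\<dots> \<le> p * (2 * R * (n * \<bar>c k\<bar>) + 8 * n * R * \<bar>c k\<bar>)"
      using pos ck by (intro mult_left_mono add_right_mono) auto
    also have "\<dots> = (10 * n * R * p) * \<bar>c k\<bar>"
      by (simp add: algebra_simps)
    finally show ?thesis
      using ck n by (auto simp: mult_le_cancel_right)
  qed
  define g where "g i = 1 / (1 + (\<mu> i)\<^sup>2)" for i
  have one_plus: "1 + (\<mu> i)\<^sup>2 > 0" for i
    by (simp add: add_pos_nonneg)
  have g_pos: "g i > 0" for i
    using one_plus by (simp add: g_def)
  have g_le: "g i \<le> g k" for i
  proof (cases "i = k")
    case False
    then have "\<bar>\<mu> k\<bar> \<le> \<bar>\<mu> i\<bar>"
      using \<mu>k \<mu>_other[of i] by linarith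
    then have "(\<mu> k)\<^sup>2 \<le> (\<mu> i)\<^sup>2"
      by (simp add: abs_le_square_iff)
    then show ?thesis
      using one_plus by (simp add: g_def frac_le)
  qed simp
  \<comment> \<open>Common scale of the error terms: \<open>p \<le> K\<close> since
    \<open>\<eta> \<le> R^2\<close>, and the first order condition bounds
    \<open>h i * (\<mu> i * c i)\<close> by a multiple of \<open>K\<close>.\<close>
  define K where "K = (p * R\<^sup>2) / \<eta>"
  have K_pos: "K > 0"
    using pos by (simp add: K_def)
  have L_nonneg: "0 \<le> 2 * K + 4 * K * (2 + 8 * n)"
    using K_pos n by (intro add_nonneg_nonneg mult_nonneg_nonneg) auto
  have lower: "- (2 * K + 4 * K * (2 + 8 * n)) \<le> - 2 * p + 2 * h i * (\<mu> i * c i)" for i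
  proof -
    have "p = (p * \<eta>) / \<eta>"
      using pos by simp
    also have "\<dots> \<le> K"
      unfolding K_def using pos by (intro divide_right_mono mult_left_mono) auto
    finally have "p \<le> K" .
    moreover have "\<bar>2 * h i * (\<mu> i * c i)\<bar> \<le> 4 * K * (2 + 8 * n)"
    proof -
      have "\<eta> * \<bar>\<mu> i * c i\<bar> = p * \<bar>h i + 2 * (A * u) * c i\<bar>"
        by (rule first_abs)
      also have "\<dots> \<le> p * (2 * R + 8 * n * R * 1)"
      proof (intro mult_left_mono)
        have "\<bar>2 * (A * u) * c i\<bar> = 2 * (A * u) * \<bar>c i\<bar>"
          using A_pos u pos by (simp add: abs_mult)
        also have "\<dots> \<le> 8 * n * R * 1"
          by (intro mult_mono Au' c1 nR) auto
        finally show "\<bar>h i + 2 * (A * u) * c i\<bar> \<le> 2 * R + 8 * n * R * 1"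
          using h[of i] by linarith
      qed (use pos in simp)
      finally have "\<bar>\<mu> i * c i\<bar> \<le> p * R * (2 + 8 * n) / \<eta>"
        using pos(4) by (simp add: field_simps)
      then have "\<bar>2 * h i\<bar> * \<bar>\<mu> i * c i\<bar> \<le> (4 * R) * (p * R * (2 + 8 * n) / \<eta>)"
        using h[of i] pos(2) by (intro mult_mono) auto
      then show ?thesis
        by (simp add: abs_mult K_def power2_eq_square ac_simps)
    qed
    ultimately show ?thesis
      by linarith
  qed
  \<comment> \<open>Lower bound for the second order terms without \<open>q\<close>, weighted by
    \<open>g i\<close>. Errors are charged at the largest weight \<open>g k\<close>. At
    \<open>k\<close> the gain comes from \<open>2 A p^2 / n\<close>, and the loss
    \<open>80 n^2 K\<close> is \<open>8 n R\<close> times the bound on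
    \<open>|\<mu> k|\<close>.\<close>
  define T where "T i = - (2 * K + 4 * K * (2 + 8 * n)) * g k + (if i = k then 4 * R * p\<^sup>2 / M * g k - 80 * n\<^sup>2 * K * g k else 0)" for i
  have "T i + \<eta> * (q i * g i) \<le> 0" for i
  proof -
    let ?E = "- 2 * p + 2 * h i * (\<mu> i * c i)" and ?F = "2 * A * (p * c i)\<^sup>2 + 2 * A * u * \<mu> i"
    have "(?E + \<eta> * q i + ?F) * g i \<le> 0"
      using second[of i] g_pos[of i] by (intro mult_nonpos_nonneg) auto
    then have le: "?E * g i + ?F * g i + \<eta> * (q i * g i) \<le> 0"
      by (simp add: algebra_simps)
    have "- (2 * K + 4 * K * (2 + 8 * n)) * g k \<le> - (2 * K + 4 * K * (2 + 8 * n)) * g i"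
      using L_nonneg g_le[of i] by (intro mult_left_mono_neg) linarith+
    also have "\<dots> \<le> ?E * g i"
      using lower[of i] g_pos[of i] by (intro mult_right_mono) auto
    finally have E: "- (2 * K + 4 * K * (2 + 8 * n)) * g k \<le> ?E * g i" .
    have F: "(if i = k then 4 * R * p\<^sup>2 / M * g k - 80 * n\<^sup>2 * K * g k else 0) \<le> ?F * g i"
    proof (cases "i = k")
      case True
      have "4 * R * p\<^sup>2 / M = 2 * A * p\<^sup>2 * (1 / n)"
        using n pos by (simp add: A)
      also have "\<dots> \<le> 2 * A * p\<^sup>2 * (c k)\<^sup>2"
        using k A_pos by (intro mult_left_mono) auto
      finally have 1: "4 * R * p\<^sup>2 / M \<le> 2 * A * (p * c k)\<^sup>2"
        by (simp add: power_mult_distrib)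
      have "\<bar>\<mu> k\<bar> \<le> 10 * n * R * p / \<eta>"
        using \<eta>\<mu> pos(4) by (simp add: field_simps)
      then have "(2 * (A * u)) * \<bar>\<mu> k\<bar> \<le> (8 * n * R) * (10 * n * R * p / \<eta>)"
        using pos n by (intro mult_mono Au' nR) auto
      also have "\<dots> = 80 * n\<^sup>2 * K"
        by (simp add: K_def power2_eq_square)
      finally have "- (80 * n\<^sup>2 * K) \<le> 2 * A * u * \<mu> k"
        using \<mu>k by (simp add: mult.assoc)
      with 1 have "4 * R * p\<^sup>2 / M - 80 * n\<^sup>2 * K \<le> 2 * A * (p * c k)\<^sup>2 + 2 * A * u * \<mu> k"
        by linarith
      from mult_right_mono[OF this, of "g k"] True g_pos[of k] show ?thesis
        by (simp add: left_diff_distrib)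
    next
      case False
      then have "\<mu> i \<ge> 0"
        using \<mu>_other[of i] \<mu>k by simp
      then have "0 \<le> ?F * g i"
        using A_pos u pos g_pos[of i] by (intro mult_nonneg_nonneg add_nonneg_nonneg) auto
      then show ?thesis
        using False by simp
    qed
    show ?thesis
      using le E F unfolding T_def by linarith
  qed
  \<comment> \<open>Summation eliminates the third derivatives through the linearized
    equation.\<close>
  then have "(\<Sum>i\<in>UNIV. T i + \<eta> * (q i * g i)) \<le> 0"
    by (intro sum_nonpos) auto
  also have "(\<Sum>i\<in>UNIV. T i + \<eta> * (q i * g i)) = (\<Sum>i\<in>UNIV. T i) + \<eta> * (\<Sum>i\<in>UNIV. q i / (1 + (\<mu> i)\<^sup>2))"
    by (simp add: sum.distrib sum_distrib_left g_def)
  also have "\<dots> = (\<Sum>i\<in>UNIV. T i)"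
    by (simp add: lin)
  also have "\<dots> = n * (- (2 * K + 4 * K * (2 + 8 * n)) * g k) + (4 * R * p\<^sup>2 / M * g k - 80 * n\<^sup>2 * K * g k)"
    unfolding T_def sum.distrib sum_constant n_def[symmetric] by simp
  also have "\<dots> = g k * (4 * R * p\<^sup>2 / M - 80 * n\<^sup>2 * K - n * (2 * K + 4 * K * (2 + 8 * n)))"
    by (simp add: algebra_simps)
  finally have "4 * R * p\<^sup>2 / M \<le> 80 * n\<^sup>2 * K + n * (2 * K + 4 * K * (2 + 8 * n))"
    using g_pos[of k] by (simp add: mult_le_0_iff)
  also have "\<dots> = K * (112 * n\<^sup>2 + 10 * n)"
    by (simp add: algebra_simps power2_eq_square)
  \<comment> \<open>Rounded up to 124 = 4 * 31, so that cancelling \<open>4 R p\<close> leaves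
    31.\<close>
  also have "\<dots> \<le> K * (124 * n\<^sup>2)"
    using K_pos n by (intro mult_left_mono) (auto simp: power2_eq_square)
  finally have "4 * R * p\<^sup>2 / M \<le> K * (124 * n\<^sup>2)" .
  then have "4 * R * p\<^sup>2 * \<eta> \<le> p * R\<^sup>2 * (124 * n\<^sup>2) * M"
    using pos by (simp add: K_def field_simps)
  then have "(4 * R * p) * (\<eta> * p) \<le> (4 * R * p) * (31 * n\<^sup>2 * R * M)"
    by (simp add: power2_eq_square ac_simps)
  then show ?thesis
    by (rule mult_left_le_imp_le) (use pos in simp)
qed

section \<open>The gradient estimate\<close>

text \<open>\<open>G\<close>, \<open>H\<close> and \<open>T\<close> stand for the first, second and third derivatives of \<open>u\<close>. Abstracting from
  \<^const>\<open>frechet_derivative\<close> makes the class visibly invariant under \<open>u \<mapsto> - u\<close>, \<open>\<Theta> \<mapsto> - \<Theta>\<close>.\<close>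

locale special_lagrangian_jet =
  fixes S :: "(real ^ 'n) set" and \<Theta> :: real and u :: "real ^ 'n \<Rightarrow> real"
    and G :: "real ^ 'n \<Rightarrow> real ^ 'n" and H :: "real ^ 'n \<Rightarrow> real ^ 'n ^ 'n"
    and T :: "real ^ 'n \<Rightarrow> 'n \<Rightarrow> 'n \<Rightarrow> real ^ 'n"
  assumes open_S: "open S"
    and u_deriv: "y \<in> S \<Longrightarrow> (u has_derivative (\<lambda>h. G y \<bullet> h)) (at y)"
    and G_deriv: "y \<in> S \<Longrightarrow> (G has_derivative (\<lambda>h. H y *v h)) (at y)"
    and H_deriv: "y \<in> S \<Longrightarrow> ((\<lambda>y. H y $ i $ j) has_derivative (\<lambda>h. T y i j \<bullet> h)) (at y)"
    and H_sym: "y \<in> S \<Longrightarrow> transpose (H y) = H y"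
    and T_sym: "y \<in> S \<Longrightarrow> T y i j $ k = T y k j $ i"
    and phase: "\<lbrakk>y \<in> S; orthonormal (b :: 'n \<Rightarrow> real ^ 'n); \<And>i. H y *v b i = \<mu> i *\<^sub>R b i\<rbrakk> \<Longrightarrow> (\<Sum>i\<in>UNIV. arctan (\<mu> i)) = \<Theta>"
begin

text \<open>The trilinear form of third derivatives: \<open>v\<close> and \<open>w\<close> fill the
  Hessian slots, \<open>z\<close> is the direction of differentiation.\<close>

definition third :: "real ^ 'n \<Rightarrow> real ^ 'n \<Rightarrow> real ^ 'n \<Rightarrow> real ^ 'n \<Rightarrow> real" where
  "third y v w z = (\<Sum>i\<in>UNIV. \<Sum>j\<in>UNIV. v $ i * (T y i j \<bullet> z) * w $ j)"

text \<open>Turns the second derivative of the \<open>e\<close>-derivative of \<open>u\<close> along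
  \<open>b i\<close> into the \<open>e\<close>-derivative of the Hessian entry at
  \<open>b i\<close>, the form in which the linearized equation is obtained.\<close>

lemma third_swap:
  assumes "y \<in> S"
  shows "third y v w z = third y z w v"
proof -
  have "third y v w z = (\<Sum>i\<in>UNIV. \<Sum>j\<in>UNIV. \<Sum>k\<in>UNIV. v $ i * (T y i j $ k * z $ k) * w $ j)"
    by (simp add: third_def inner_vec_def sum_distrib_left sum_distrib_right)
  also have "\<dots> = (\<Sum>k\<in>UNIV. \<Sum>i\<in>UNIV. \<Sum>j\<in>UNIV. v $ i * (T y i j $ k * z $ k) * w $ j)"
    by (subst (2) sum.swap, subst sum.swap) (rule refl)
  also have "\<dots> = (\<Sum>k\<in>UNIV. \<Sum>j\<in>UNIV. \<Sum>i\<in>UNIV. z $ k * (T y k j $ i * v $ i) * w $ j)"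
    by (subst (2) sum.swap) (simp add: T_sym[OF assms] ac_simps)
  also have "\<dots> = third y z w v"
    by (simp add: third_def inner_vec_def sum_distrib_left sum_distrib_right)
  finally show ?thesis .
qed

lemma line_deriv: "((\<lambda>t. x + t *\<^sub>R b) has_derivative (\<lambda>t. t *\<^sub>R b)) (at t)"
  by (auto intro!: derivative_eq_intros)

lemma u_line_deriv:
  assumes "x + t *\<^sub>R b \<in> S"
  shows "((\<lambda>t. u (x + t *\<^sub>R b)) has_real_derivative G (x + t *\<^sub>R b) \<bullet> b) (at t)"
  using has_derivative_compose[OF line_deriv u_deriv[OF assms]]
  by (simp add: has_field_derivative_def mult_commute_abs)

lemma G_line_deriv:
  assumes "x + t *\<^sub>R b \<in> S"
  shows "((\<lambda>t. G (x + t *\<^sub>R b) \<bullet> e) has_real_derivative e \<bullet> (H (x + t *\<^sub>R b) *v b)) (at t)"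
proof -
  have "((\<lambda>t. G (x + t *\<^sub>R b) \<bullet> e) has_derivative (\<lambda>h. (H (x + t *\<^sub>R b) *v (h *\<^sub>R b)) \<bullet> e)) (at t)"
    by (intro has_derivative_inner_left has_derivative_compose[OF line_deriv G_deriv[OF assms]])
  then show ?thesis
    by (simp add: has_field_derivative_def matrix_vector_mult_scaleR mult_commute_abs inner_commute)
qed

lemma H_line_deriv:
  assumes "x + t *\<^sub>R b \<in> S"
  shows "((\<lambda>t. v \<bullet> (H (x + t *\<^sub>R b) *v w)) has_real_derivative third (x + t *\<^sub>R b) v w b) (at t)"
proof -
  have "((\<lambda>t. H (x + t *\<^sub>R b) $ i $ j) has_real_derivative T (x + t *\<^sub>R b) i j \<bullet> b) (at t)" for i j
    using has_derivative_compose[OF line_deriv H_deriv[OF assms]]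
    by (simp add: has_field_derivative_def mult_commute_abs)
  then have "((\<lambda>t. \<Sum>i\<in>UNIV. \<Sum>j\<in>UNIV. v $ i * H (x + t *\<^sub>R b) $ i $ j * w $ j) has_real_derivative
      third (x + t *\<^sub>R b) v w b) (at t)"
    unfolding third_def by (intro DERIV_sum DERIV_cmult_right DERIV_cmult)
  then show ?thesis
    by (simp add: inner_vec_def matrix_vector_mult_def sum_distrib_left mult.assoc)
qed

lemma continuous_on_u: "A \<subseteq> S \<Longrightarrow> continuous_on A u"
  by (rule has_derivative_continuous_on[where f' = "\<lambda>y h. G y \<bullet> h"])
    (blast intro: has_derivative_at_withinI u_deriv)

lemma continuous_on_G: "A \<subseteq> S \<Longrightarrow> continuous_on A G"
  by (rule has_derivative_continuous_on[where f' = "\<lambda>y h. H y *v h"])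
    (blast intro: has_derivative_at_withinI G_deriv)

text \<open>The Hessian along the line is written in the eigenbasis of the single point
  \<open>x\<close>, so that it is diagonal at \<open>t = 0\<close>.\<close>

lemma linearized_equation:
  fixes b :: "'n \<Rightarrow> real ^ 'n"
  assumes x: "x \<in> S" and b: "orthonormal b" and eig: "\<And>i. H x *v b i = \<mu> i *\<^sub>R b i"
  shows "(\<Sum>i\<in>UNIV. third x (b i) (b i) e / (1 + (\<mu> i)\<^sup>2)) = 0"
proof (rule linearized_phase_equation[where a = "\<lambda>i j t. b i \<bullet> (H (x + t *\<^sub>R e) *v b j)" and \<Theta> = \<Theta>
      and a' = "\<lambda>i j. third x (b i) (b j) e"])
  show "((\<lambda>t. b i \<bullet> (H (x + t *\<^sub>R e) *v b j)) has_real_derivative third x (b i) (b j) e) (at 0)" for i j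
    using H_line_deriv[of x 0 e "b i" "b j"] x by simp
  show "b i \<bullet> (H (x + 0 *\<^sub>R e) *v b j) = (if i = j then \<mu> i else 0)" for i j
    using b by (simp add: eig orthonormal_def)
  show "(\<Sum>i\<in>UNIV. arctan (\<mu> i)) = \<Theta>"
    by (rule phase[OF x b eig])
  have "((\<lambda>t. x + t *\<^sub>R e) \<longlongrightarrow> x + 0 *\<^sub>R e) (at 0)"
    by (intro tendsto_intros)
  then have "eventually (\<lambda>t. x + t *\<^sub>R e \<in> S) (at 0)"
    using open_S x by (auto dest: topological_tendstoD)
  then show "eventually (\<lambda>t. Im (cis (- \<Theta>) * det (\<chi> i j. (if i = j then 1 else 0) +
      \<i> * complex_of_real (b i \<bullet> (H (x + t *\<^sub>R e) *v b j)))) = 0) (at 0)"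
  proof eventually_elim
    case (elim t)
    \<comment> \<open>At nearby points \<open>b\<close> need not be an eigenbasis, but the
      determinant is the same in every orthonormal basis, so the eigenbasis \<open>b'\<close> there
      evaluates it.\<close>
    obtain b' :: "'n \<Rightarrow> real ^ 'n" and \<mu>' where b': "orthonormal b'" "\<And>i. H (x + t *\<^sub>R e) *v b' i = \<mu>' i *\<^sub>R b' i"
      by (rule symmetric_matrix_orthonormal_eigenbasis[OF H_sym[OF elim]]) (rule that)
    have "det (\<chi> i j. (if i = j then 1 else 0) + \<i> * complex_of_real (b i \<bullet> (H (x + t *\<^sub>R e) *v b j))) =
        (\<Prod>i\<in>UNIV. 1 + \<i> * complex_of_real (\<mu>' i))"
      using det_pencil_orthonormal_basis[OF b, where h = complex_of_real and c = 1 and d = \<i>]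
        det_one_plus_ii_eigenbasis[OF b']
      by simp
    moreover have "cis (- \<Theta>) * (\<Prod>i\<in>UNIV. 1 + \<i> * complex_of_real (\<mu>' i)) =
        complex_of_real (\<Prod>i\<in>UNIV. sqrt (1 + (\<mu>' i)\<^sup>2))"
      unfolding phase[OF elim b', symmetric] by (rule cis_minus_sum_arctan_times_prod) simp
    ultimately show ?case
      by (simp only: Im_complex_of_real)
  qed
qed

text \<open>Freezing the direction \<open>e\<close> yields a function \<open>f \<le> w\<close> with
  equality at \<open>x\<close>, so \<open>f\<close> has a maximum there as well. Its first and
  second derivatives along the eigenvector lines supply the pointwise conditions of
  \<open>interior_maximum_bound\<close>.\<close>

lemma interior_max_gradient_bound:
  fixes x0 x :: "real ^ 'n" and R M c :: real
  defines "n \<equiv> real CARD('n)"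
  defines "w \<equiv> \<lambda>y. (R\<^sup>2 - (y - x0) \<bullet> (y - x0)) * norm (G y) + 2 * n * R / M * (u y + c)\<^sup>2"
  assumes \<Theta>: "\<Theta> \<ge> (n - 2) * (pi / 2)" and pos: "R > 0" "M > 0"
    and S: "ball x0 R \<subseteq> S" and u: "M \<le> u x + c" "u x + c \<le> 2 * M"
    and x: "x \<in> ball x0 R" "G x \<noteq> 0" and max: "\<And>y. y \<in> ball x0 R \<Longrightarrow> w y \<le> w x"
  shows "(R\<^sup>2 - (x - x0) \<bullet> (x - x0)) * norm (G x) \<le> 31 * n\<^sup>2 * R * M"
proof -
  define A where "A = 2 * n * R / M"
  define \<eta> where "\<eta> y = R\<^sup>2 - (y - x0) \<bullet> (y - x0)" for y
  define p where "p = norm (G x)"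
  define e where "e = G x /\<^sub>R p"
  have p: "p > 0"
    using x by (simp add: p_def)
  have Gx: "G x = p *\<^sub>R e"
    using p by (simp add: e_def)
  have e: "norm e = 1"
    using p by (simp add: e_def p_def)
  have xS: "x \<in> S"
    using x S by blast
  obtain b :: "'n \<Rightarrow> real ^ 'n" and \<mu> where b: "orthonormal b" and eig: "\<And>i. H x *v b i = \<mu> i *\<^sub>R b i"
    by (rule symmetric_matrix_orthonormal_eigenbasis[OF H_sym[OF xS]]) (rule that)
  have b1: "b i \<bullet> b i = 1" for i
    using b by (simp add: orthonormal_def)
  have norm_b: "norm (b i) = 1" for i
    using b1 by (simp add: norm_eq_1)
  define f where "f y = \<eta> y * (G y \<bullet> e) + A * (u y + c)\<^sup>2" for y
  obtain d where d: "d > 0" "ball x d \<subseteq> ball x0 R"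
    using x open_ball open_contains_ball by blast
  have near: "x + t *\<^sub>R b i \<in> ball x0 R" if "\<bar>t\<bar> < d" for t i
  proof -
    have "x + t *\<^sub>R b i \<in> ball x d"
      using that norm_b by (simp add: dist_norm)
    with d show ?thesis by blast
  qed
  have f_max: "f y \<le> f x" if "y \<in> ball x0 R" for y
  proof -
    have "norm (y - x0) \<le> R"
      using that by (simp add: dist_norm norm_minus_commute)
    then have "(norm (y - x0))\<^sup>2 \<le> R\<^sup>2"
      by (intro power_mono) auto
    then have "\<eta> y \<ge> 0"
      by (simp add: \<eta>_def power2_norm_eq_inner)
    moreover have "G y \<bullet> e \<le> norm (G y)"
      using norm_cauchy_schwarz[of "G y" e] e by simp
    ultimately have "f y \<le> w y"
      by (simp add: f_def w_def A_def \<eta>_def mult_left_mono)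
    also have "\<dots> \<le> w x"
      using that by (rule max)
    also have "w x = f x"
      using e p by (simp add: f_def w_def A_def \<eta>_def Gx norm_eq_1)
    finally show ?thesis .
  qed
  define \<phi>' where "\<phi>' i t = - 2 * ((x - x0) \<bullet> b i + t) * (G (x + t *\<^sub>R b i) \<bullet> e) +
    \<eta> (x + t *\<^sub>R b i) * (e \<bullet> (H (x + t *\<^sub>R b i) *v b i)) +
    2 * A * (u (x + t *\<^sub>R b i) + c) * (G (x + t *\<^sub>R b i) \<bullet> b i)" for i t
  have \<eta>_line: "\<eta> (x + t *\<^sub>R b i) = \<eta> x - 2 * ((x - x0) \<bullet> b i) * t - t\<^sup>2" for i t
    using b1[of i] by (simp add: \<eta>_def inner_simps inner_commute algebra_simps power2_eq_square)
  have \<eta>_deriv: "((\<lambda>t. \<eta> (x + t *\<^sub>R b i)) has_real_derivative - 2 * ((x - x0) \<bullet> b i + t)) (at t)" for i t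
    unfolding \<eta>_line by (auto intro!: derivative_eq_intros)
  have \<phi>: "((\<lambda>t. f (x + t *\<^sub>R b i)) has_real_derivative \<phi>' i t) (at t)" if "\<bar>t\<bar> < d" for i t
  proof -
    have "x + t *\<^sub>R b i \<in> S"
      using near[OF that] S by blast
    note derivs = u_line_deriv[OF this] G_line_deriv[OF this, of e]
    show ?thesis
      unfolding f_def \<phi>'_def
      by (rule derivative_eq_intros \<eta>_deriv derivs refl)+ (simp add: algebra_simps)
  qed
  \<comment> \<open>The eigenvector equation and \<open>G x = p e\<close> have been inserted into
    the second derivative at \<open>x\<close>.\<close>
  define D where "D i = - 2 * p + 2 * (- 2 * ((x - x0) \<bullet> b i)) * (\<mu> i * (e \<bullet> b i)) + \<eta> x * third x e (b i) (b i) +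
    2 * A * (p * (e \<bullet> b i))\<^sup>2 + 2 * A * (u x + c) * \<mu> i" for i
  have \<phi>'_deriv: "(\<phi>' i has_real_derivative D i) (at 0)" for i
  proof -
    have xS': "x + 0 *\<^sub>R b i \<in> S"
      using xS by simp
    note derivs = u_line_deriv[OF xS'] G_line_deriv[OF xS'] H_line_deriv[OF xS'] \<eta>_deriv
    show ?thesis
      unfolding \<phi>'_def
      by (rule derivative_eq_intros derivs refl)+
        (use e p b1 in \<open>simp add: D_def eig Gx norm_eq_1 algebra_simps power2_eq_square\<close>)
  qed
  have crit: "\<phi>' i 0 = 0" "D i \<le> 0" for i
    using second_derivative_local_max[OF d(1) \<phi> \<phi>'_deriv, of i] f_max near by auto
  have "\<eta> x * p \<le> 31 * (real CARD('n))\<^sup>2 * R * M"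
  proof (rule interior_maximum_bound[where \<mu> = \<mu> and c = "\<lambda>i. e \<bullet> b i" and h = "\<lambda>i. - 2 * ((x - x0) \<bullet> b i)"
        and q = "\<lambda>i. third x e (b i) (b i)" and u = "u x + c" and A = A])
    have lt: "norm (x - x0) < R"
      using x by (simp add: dist_norm norm_minus_commute)
    then have "(norm (x - x0))\<^sup>2 < R\<^sup>2"
      by (intro power_strict_mono) auto
    then show "\<eta> x > 0" "\<eta> x \<le> R\<^sup>2"
      by (simp_all add: \<eta>_def power2_norm_eq_inner)
    show "\<bar>- 2 * ((x - x0) \<bullet> b i)\<bar> \<le> 2 * R" for i
      using Cauchy_Schwarz_ineq2[of "x - x0" "b i"] lt norm_b[of i] by simp
    show "(\<Sum>i\<in>UNIV. (e \<bullet> b i)\<^sup>2) = 1"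
      using orthonormal_parseval[OF b, of e e] e by (simp add: norm_eq_1 power2_eq_square inner_commute)
    show "- 2 * ((x - x0) \<bullet> b i) * p + \<eta> x * (\<mu> i * (e \<bullet> b i)) + 2 * A * (u x + c) * (p * (e \<bullet> b i)) = 0" for i
      using crit(1)[of i] e by (simp add: \<phi>'_def eig Gx norm_eq_1)
    show "- 2 * p + 2 * (- 2 * ((x - x0) \<bullet> b i)) * (\<mu> i * (e \<bullet> b i)) + \<eta> x * third x e (b i) (b i) +
      2 * A * (p * (e \<bullet> b i))\<^sup>2 + 2 * A * (u x + c) * \<mu> i \<le> 0" for i
      using crit(2)[of i] by (simp only: D_def)
    show "(\<Sum>i\<in>UNIV. third x e (b i) (b i) / (1 + (\<mu> i)\<^sup>2)) = 0"
      using linearized_equation[OF xS b eig, of e] by (simp only: third_swap[OF xS, of e])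
    show "\<mu> i + \<mu> j \<ge> 0" if "i \<noteq> j" for i j
      using supercritical_pair_nonneg[of \<mu>, OF _ that] phase[OF xS b eig] \<Theta> by (simp add: n_def)
  qed (use pos p u A_def n_def in auto)
  then show ?thesis
    by (simp add: \<eta>_def p_def n_def)
qed

text \<open>Compare \<open>w\<close> at the centre, where the cutoff is \<open>R^2\<close>, with its
  maximum. The gradient term contributes 31 and the quadratic term 8 to the constant 39.\<close>

lemma gradient_bound_supercritical:
  fixes x0 :: "real ^ 'n" and R M c :: real
  defines "n \<equiv> real CARD('n)"
  assumes \<Theta>: "\<Theta> \<ge> (n - 2) * (pi / 2)" and pos: "R > 0" "M > 0" and S: "cball x0 R \<subseteq> S"
    and u: "\<And>y. y \<in> cball x0 R \<Longrightarrow> M \<le> u y + c \<and> u y + c \<le> 2 * M"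
  shows "norm (G x0) \<le> 39 * n\<^sup>2 * (M / R)"
proof -
  define w where "w y = (R\<^sup>2 - (y - x0) \<bullet> (y - x0)) * norm (G y) + 2 * n * R / M * (u y + c)\<^sup>2" for y
  have n: "n \<ge> 1"
    by (simp add: n_def Suc_leI)
  have "continuous_on (cball x0 R) w"
    unfolding w_def by (intro continuous_intros continuous_on_u[OF S] continuous_on_G[OF S])
  then obtain x where x: "x \<in> cball x0 R" and max: "\<And>y. y \<in> cball x0 R \<Longrightarrow> w y \<le> w x"
    using continuous_attains_sup[of "cball x0 R" w] pos by auto
  have "2 * n * R / M * (u x + c)\<^sup>2 \<le> 2 * n * R / M * (2 * M)\<^sup>2"
    using u[OF x] pos n by (intro mult_left_mono power_mono) auto
  also have "\<dots> = 8 * n * R * M"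
    using pos by (simp add: power2_eq_square)
  also have "\<dots> \<le> 8 * n\<^sup>2 * R * M"
    using n pos by (intro mult_right_mono) (auto simp: power2_eq_square)
  finally have uu: "2 * n * R / M * (u x + c)\<^sup>2 \<le> 8 * n\<^sup>2 * R * M" .
  have "(R\<^sup>2 - (x - x0) \<bullet> (x - x0)) * norm (G x) \<le> 31 * n\<^sup>2 * R * M"
  proof (cases "x \<in> ball x0 R \<and> G x \<noteq> 0")
    case True
    then show ?thesis
      unfolding n_def
      using S u[OF x] max \<Theta> pos by (intro interior_max_gradient_bound[where c = c])
        (auto simp: w_def n_def)
  next
    case False
    \<comment> \<open>A maximum on the sphere has vanishing cutoff; otherwise the gradient itself
      vanishes.\<close>
    then have "(R\<^sup>2 - (x - x0) \<bullet> (x - x0)) * norm (G x) = 0"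
      using x by (auto simp: dist_norm norm_minus_commute power2_norm_eq_inner[symmetric])
    moreover have "0 \<le> 31 * n\<^sup>2 * R * M"
      using pos by simp
    ultimately show ?thesis
      by linarith
  qed
  then have "w x \<le> 39 * n\<^sup>2 * R * M"
    using uu by (simp add: w_def)
  moreover have "R\<^sup>2 * norm (G x0) \<le> w x0"
    using pos n by (simp add: w_def)
  moreover have "w x0 \<le> w x"
    using pos by (intro max) auto
  ultimately have "R * (R * norm (G x0)) \<le> R * (39 * n\<^sup>2 * M)"
    by (simp add: power2_eq_square ac_simps)
  then show ?thesis
    using pos by (simp add: field_simps)
qed

text \<open>The eigenvectors stay, the eigenvalues change sign, and \<open>arctan\<close> is
  odd.\<close>

lemma uminus_jet:
  "special_lagrangian_jet S (- \<Theta>) (\<lambda>y. - u y) (\<lambda>y. - G y) (\<lambda>y. - H y) (\<lambda>y i j. - T y i j)"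
proof
  show "open S" by (rule open_S)
  fix y assume y: "y \<in> S"
  show "((\<lambda>y. - u y) has_derivative (\<lambda>h. - G y \<bullet> h)) (at y)"
    using has_derivative_minus[OF u_deriv[OF y]] by simp
  show "((\<lambda>y. - G y) has_derivative (\<lambda>h. - H y *v h)) (at y)"
    using has_derivative_minus[OF G_deriv[OF y]]
    by (simp add: matrix_vector_mult_def vec_eq_iff sum_negf uminus_vec_def)
  show "((\<lambda>y. (- H y) $ i $ j) has_derivative (\<lambda>h. - T y i j \<bullet> h)) (at y)" for i j
    using has_derivative_minus[OF H_deriv[OF y]] by simp
  show "transpose (- H y) = - H y"
    using H_sym[OF y] by (simp add: transpose_def vec_eq_iff)
  show "(- T y i j) $ k = (- T y k j) $ i" for i j k
    using T_sym[OF y] by simp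
  fix b :: "'n \<Rightarrow> real ^ 'n" and \<mu> assume b: "orthonormal b" and eig: "\<And>i. - H y *v b i = \<mu> i *\<^sub>R b i"
  have "H y *v b i = (- \<mu> i) *\<^sub>R b i" for i
  proof -
    have "H y *v b i = - (- H y *v b i)"
      by (simp add: matrix_vector_mult_def vec_eq_iff sum_negf)
    then show ?thesis
      using eig by simp
  qed
  from phase[OF y b this] show "(\<Sum>i\<in>UNIV. arctan (\<mu> i)) = - \<Theta>"
    by (simp add: arctan_minus sum_negf)
qed

lemma gradient_bound:
  fixes x0 :: "real ^ 'n" and R a K :: real
  assumes \<Theta>: "\<bar>\<Theta>\<bar> \<ge> (real CARD('n) - 2) * (pi / 2)" and pos: "R > 0" and S: "cball x0 R \<subseteq> S"
    and u: "\<And>y. y \<in> cball x0 R \<Longrightarrow> a \<le> u y \<and> u y \<le> a + K"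
  shows "norm (G x0) \<le> 39 * (real CARD('n))\<^sup>2 * (K / R + 1)"
proof -
  have "K \<ge> 0"
    using u[of x0] pos by simp
  \<comment> \<open>Adding \<open>R\<close> keeps \<open>M\<close> positive for constant
    \<open>u\<close> and produces the summand 1 in the estimate.\<close>
  then have M: "K + R > 0"
    using pos by simp
  have "norm (G x0) \<le> 39 * (real CARD('n))\<^sup>2 * ((K + R) / R)"
  proof (cases "\<Theta> \<ge> 0")
    case True
    \<comment> \<open>The shift puts \<open>u + c\<close> between \<open>K + R\<close> and
      \<open>2 K + R\<close>, hence in \<open>[M, 2 M]\<close>.\<close>
    then show ?thesis
      using \<Theta> u pos \<open>K \<ge> 0\<close>
      by (intro gradient_bound_supercritical[OF _ pos M S, of "K + R - a"]) force+
  next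
    case False
    interpret minus: special_lagrangian_jet S "- \<Theta>" "\<lambda>y. - u y" "\<lambda>y. - G y" "\<lambda>y. - H y" "\<lambda>y i j. - T y i j"
      by (rule uminus_jet)
    \<comment> \<open>For \<open>- u\<close> the shift \<open>a + 2 K + R\<close> gives the same
      range.\<close>
    have "norm (- G x0) \<le> 39 * (real CARD('n))\<^sup>2 * ((K + R) / R)"
      using False \<Theta> u pos \<open>K \<ge> 0\<close>
      by (intro minus.gradient_bound_supercritical[OF _ pos M S, of "a + 2 * K + R"]) force+
    then show ?thesis
      by simp
  qed
  then show ?thesis
    using pos by (simp add: add_divide_distrib)
qed

end

section \<open>From smooth solutions to jets\<close>

lemma Ck_on_partial_deriv: "Ck_on (Suc k) S f \<Longrightarrow> Ck_on k S (partial_deriv i f)"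
  by simp

lemma special_lagrangian_jet_of_smooth:
  fixes u :: "real ^ 'n \<Rightarrow> real"
  assumes S: "open S" and u: "smooth_on S u" and sl: "special_lagrangian_on S \<Theta> u"
  shows "special_lagrangian_jet S \<Theta> u (gradient u) (hessian u) (\<lambda>y i j. gradient (\<lambda>y. hessian u y $ i $ j) y)"
proof
  have Ck: "Ck_on k S u" "Ck_on k S (partial_deriv i u)" "Ck_on k S (partial_deriv i (partial_deriv j u))" for k i j
    using u by (auto simp: smooth_on_def intro: Ck_on_partial_deriv)
  have diff: "f differentiable (at y)" if "Ck_on 1 S f" "y \<in> S" for f :: "real ^ 'n \<Rightarrow> real" and y
    using that by simp
  show "open S" by fact
  fix y assume y: "y \<in> S"
  show "(u has_derivative (\<lambda>h. gradient u y \<bullet> h)) (at y)"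
    by (intro has_derivative_gradient diff[OF _ y] Ck)
  have sym: "hessian u y $ i $ j = hessian u y $ j $ i" for i j
    using partial_deriv_commute[OF S y Ck(1)] by (simp add: hessian_def)
  then show "transpose (hessian u y) = hessian u y"
    by (simp add: transpose_def vec_eq_iff)
  have "((\<lambda>y. gradient u y $ i) has_derivative (\<lambda>h. (hessian u y *v h) $ i)) (at y)" for i
  proof -
    have "((\<lambda>y. partial_deriv i u y) has_derivative (\<lambda>h. gradient (partial_deriv i u) y \<bullet> h)) (at y)"
      by (intro has_derivative_gradient diff[OF _ y] Ck)
    \<comment> \<open>The new derivative is the first index of \<open>hessian\<close>, so the
      gradient of \<open>partial_deriv i u\<close> is a column; symmetry turns it into the row of
      the matrix product.\<close>
    moreover have "gradient (partial_deriv i u) y \<bullet> h = (hessian u y *v h) $ i" for h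
      by (simp add: matrix_vector_mult_def inner_vec_def sym[of i])
        (simp add: gradient_def hessian_def)
    ultimately show ?thesis
      by (simp add: gradient_def)
  qed
  then show "(gradient u has_derivative (\<lambda>h. hessian u y *v h)) (at y)"
    by (subst has_derivative_componentwise_within)
      (auto simp: Basis_vec_def inner_axis)
  show "((\<lambda>y. hessian u y $ i $ j) has_derivative (\<lambda>h. gradient (\<lambda>y. hessian u y $ i $ j) y \<bullet> h)) (at y)" for i j
    unfolding hessian_def vec_lambda_beta
    by (intro has_derivative_gradient diff[OF _ y] Ck)
  \<comment> \<open>The two outer derivatives of \<open>partial_deriv j u\<close> are
    exchanged.\<close>
  show "gradient (\<lambda>y. hessian u y $ i $ j) y $ k = gradient (\<lambda>y. hessian u y $ k $ j) y $ i" for i j k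
    using partial_deriv_commute[OF S y Ck(2)] by (simp add: gradient_def hessian_def)
  fix b :: "'n \<Rightarrow> real ^ 'n" and \<mu>
  assume "orthonormal b" "\<And>i. hessian u y *v b i = \<mu> i *\<^sub>R b i"
  then have "eigenvalues (hessian u y) = image_mset \<mu> (mset_set UNIV)"
    by (rule eigenvalues_eigenbasis)
  moreover have "(\<Sum>\<mu>\<in>#eigenvalues (hessian u y). arctan \<mu>) = \<Theta>"
    using sl y by (simp add: special_lagrangian_on_def)
  ultimately show "(\<Sum>i\<in>UNIV. arctan (\<mu> i)) = \<Theta>"
    by (simp add: image_mset.compositionality o_def sum_unfold_sum_mset)
qed

section \<open>Oscillation and the final estimate\<close>

lemma ereal_diff_le_osc:
  assumes "x \<in> S" "y \<in> S"
  shows "ereal (v x - v y) \<le> osc S v"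
proof -
  have "ereal (v x) - ereal (v y) \<le> (SUP x\<in>S. ereal (v x)) - (INF x\<in>S. ereal (v x))"
    using assms by (intro ereal_minus_mono SUP_upper INF_lower)
  then show ?thesis
    by (simp add: osc_def)
qed

theorem theorem1p3:
  "\<exists>C>0::real. \<forall>(R::real) (\<Theta>::real) (u :: real ^ 'n::finite \<Rightarrow> real).
     R > 0 \<longrightarrow>
     \<bar>\<Theta>\<bar> \<ge> (real CARD('n) - 2) * (pi / 2) \<longrightarrow>
     smooth_on (ball 0 (3 * R)) u \<longrightarrow>
     special_lagrangian_on (ball 0 (3 * R)) \<Theta> u \<longrightarrow>
     (SUP x\<in>ball 0 R. ereal (norm (gradient u x)))
       \<le> ereal C * (osc (ball 0 (3 * R)) (\<lambda>x. u x / R) + 1)"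
proof (rule exI[of _ "39 * (real CARD('n))\<^sup>2"], intro conjI allI impI SUP_least)
  show pos: "0 < 39 * (real CARD('n))\<^sup>2"
    by simp
  fix R \<Theta> :: real and u :: "real ^ 'n \<Rightarrow> real" and x0 :: "real ^ 'n"
  assume R: "R > 0" and \<Theta>: "\<bar>\<Theta>\<bar> \<ge> (real CARD('n) - 2) * (pi / 2)"
    and smooth: "smooth_on (ball 0 (3 * R)) u" and sl: "special_lagrangian_on (ball 0 (3 * R)) \<Theta> u"
    and x0: "x0 \<in> ball 0 R"
  let ?S = "ball 0 (3 * R) :: (real ^ 'n) set"
  let ?osc = "osc ?S (\<lambda>x. u x / R)"
  have "(0 :: real ^ 'n) \<in> ?S"
    using R by simp
  from ereal_diff_le_osc[OF this this, of "\<lambda>x. u x / R"] have osc_nonneg: "?osc \<ge> 0"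
    by (simp add: zero_ereal_def)
  show "ereal (norm (gradient u x0)) \<le> ereal (39 * (real CARD('n))\<^sup>2) * (?osc + 1)"
  proof (cases ?osc)
    case (real k)
    have diff: "u y - u z \<le> k * R" if "y \<in> ?S" "z \<in> ?S" for y z
      using ereal_diff_le_osc[OF that, of "\<lambda>x. u x / R"] R
      by (simp add: real diff_divide_distrib[symmetric] divide_le_eq)
    \<comment> \<open>A finite oscillation \<open>k\<close> of \<open>u / R\<close> puts
      \<open>u\<close> in \<open>[a, a + k R]\<close>, so \<open>K = k R\<close> below.\<close>
    define a where "a = (INF y\<in>?S. u y)"
    have "bdd_below (u ` ?S)"
      using diff[OF \<open>0 \<in> ?S\<close>] by (intro bdd_belowI2[of _ "u 0 - k * R"]) (simp add: algebra_simps)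
    then have lower: "a \<le> u y" if "y \<in> ?S" for y
      using that by (simp add: a_def cINF_lower)
    have upper: "u y \<le> a + k * R" if "y \<in> ?S" for y
    proof -
      have "u y - k * R \<le> a"
        unfolding a_def using diff[OF that] \<open>0 \<in> ?S\<close>
        by (intro cINF_greatest) (auto simp: algebra_simps)
      then show ?thesis by simp
    qed
    \<comment> \<open>With \<open>|x0| < R\<close> the closed ball stays within distance
      \<open>2 R\<close> of the origin.\<close>
    have S: "cball x0 R \<subseteq> ?S"
    proof
      fix y assume "y \<in> cball x0 R"
      then show "y \<in> ?S"
        using x0 R dist_triangle[of 0 y x0] by simp
    qed
    interpret special_lagrangian_jet ?S \<Theta> u "gradient u" "hessian u" "\<lambda>y i j. gradient (\<lambda>y. hessian u y $ i $ j) y"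
      using open_ball smooth sl by (rule special_lagrangian_jet_of_smooth)
    have "norm (gradient u x0) \<le> 39 * (real CARD('n))\<^sup>2 * (k * R / R + 1)"
      using \<Theta> R S lower upper by (intro gradient_bound[where a = a]) blast+
    then show ?thesis
      using R by (simp add: real)
  next
    \<comment> \<open>With infinite oscillation the right-hand side is infinite, as the constant is
      positive.\<close>
    case PInf
    then show ?thesis
      using pos by simp
  next
    case MInf
    then show ?thesis
      using osc_nonneg by simp
  qed
qed

end
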